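(* Let $\Bbbk$ be an algebraically closed field, let $\mathbf{w} \in \mathbb{R}^d_{li}$, and let $C \subseteq \mathbb{R}^d$ be an open cone containing $\mathbf{w}$. For every $\mathbf{n} = (n_1,\dots,n_d) \in C \cap \mathbb{Z}^d$ and every $\boldsymbol{\theta} \in (\Bbbk^* )^d$, the function $$\phi^{\boldsymbol{\theta}}_{\mathbf{n}} \colon K_C \to \Bbbk\{\!\{x\}\!\}, \qquad \phi^{\boldsymbol{\theta}}_{\mathbf{n}}\Big(\sum c_{\mathbf{u}}\mathbf{t}^{\mathbf{u}}\Big) = \sum c_{\mathbf{u}}\boldsymbol{\theta}^{\mathbf{u}}x^{\mathbf{n}\cdot\mathbf{u}}$$ is well defined and is a ring homomorphism from $K_C$ to $\Bbbk\{\!\{x\}\!\}$.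
   Context: Set $p = \mathrm{char}(\Bbbk)$ if $\mathrm{char}(\Bbbk)>0$ and $p=1$ if $\mathrm{char}(\Bbbk)=0$. $\mathbb{R}^d_{li}$ denotes the set of vectors in $\mathbb{R}^d$ whose coordinates are linearly independent over $\mathbb{Q}$. A cone in $\mathbb{R}^d$ is a convex set closed under multiplication by positive scalars; it is pointed if its closure does not contain a line. The dual cone of $C$ is $C^\vee = \{\mathbf{x} \in \mathbb{R}^d : \mathbf{x}\cdot\mathbf{y} \ge 0 \text{ for all } \mathbf{y} \in C\}$, and $\mathrm{int}(C)$ is the interior of $C$. For $A \subseteq \mathbb{Q}^d$, $\boldsymbol{\gamma} \in \mathbb{Q}^d$ and $\mathbf{w} \in \mathbb{R}^d_{li}$ set $A^+_{\boldsymbol{\gamma},\mathbf{w}} = \{\mathbf{a}\in A : \mathbf{w}\cdot\mathbf{a} > \mathbf{w}\cdot\boldsymbol{\gamma}\}$ and $A^-_{\boldsymbol{\gamma},\mathbf{w}} = \{\mathbf{a}\in A : \mathbf{w}\cdot\mathbf{a} < \mathbf{w}\cdot\boldsymbol{\gamma}\}$. A set $A \subseteq \mathbb{Q}^d$ is $p$-discrete with respect to $\mathbf{w}$ if: (a) there is an open cone $\sigma$ containing $\mathbf{w}$ such that $\{\mathbf{w}'\cdot\mathbf{a} : \mathbf{a}\in A\}$ is well ordered for every $\mathbf{w}' \in \sigma\cap\mathbb{R}^d_{li}$; (b) there are an integer $N>0$, $\boldsymbol{\gamma}\in\mathbb{Q}^d$, and a pointed cone $C$ with $\mathbf{w}\in\mathrm{int}(C^\vee)$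 such that $A \subseteq (\boldsymbol{\gamma}+C)\cap\bigcup_{j\ge 0}\frac{1}{Np^j}\mathbb{Z}^d$; (c) for any sequence $\{\mathbf{a}_i\}$ in $A$, if $\{\mathbf{w}\cdot\mathbf{a}_i\}$ converges in $\mathbb{R}$ then $\{\mathbf{a}_i\}$ converges to a point of $\mathbb{Q}^d$; (d) for every $\boldsymbol{\gamma}'\in\mathbb{Q}^d$ there is an open cone $\sigma_{\boldsymbol{\gamma}'}$ containing $\mathbf{w}$ such that for all $\mathbf{w}'\in\sigma_{\boldsymbol{\gamma}'}\cap\mathbb{R}^d_{li}$ we have $A^+_{\boldsymbol{\gamma}',\mathbf{w}'}=A^+_{\boldsymbol{\gamma}',\mathbf{w}}$ and $A^-_{\boldsymbol{\gamma}',\mathbf{w}'}=A^-_{\boldsymbol{\gamma}',\mathbf{w}}$. $K_{\mathbf{w}}$ is the field of all formal power series $\sum_{\mathbf{u}\in\mathbb{Q}^d}c_{\mathbf{u}}\mathbf{t}^{\mathbf{u}}$ in $t_1,\dots,t_d$ with coefficients in $\Bbbk$ whose support $\{\mathbf{u}: c_{\mathbf{u}}\neq 0\}$ is $p$-discrete with respect to $\mathbf{w}$, with the usual (coefficientwise) addition and (convolution) multiplication. For an open cone $C$ containing $\mathbf{w}$, $K_C$ is the subring of $K_{\mathbf{w}}$ consisting of those elements whose support is well ordered with respect to $\preceq_{\mathbf{w}'}$ for every $\mathbf{w}'\in C\cap\mathbb{R}^d_{li}$ (where $\mathbf{u}\preceq_{\mathbf{w}'}\mathbf{v}$ means $\mathbf{w}'\cdot\mathbf{u}\le\mathbf{w}'\cdot\mathbf{v}$),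 and for which the only denominators allowed in exponents are powers of $p$ (i.e. the support lies in $\bigcup_{j\ge 0}\frac{1}{p^j}\mathbb{Z}^d$). For such exponents $\mathbf{u}$, $\boldsymbol{\theta}^{\mathbf{u}}=\theta_1^{u_1}\cdots\theta_d^{u_d}$, using the unique $p^j$-th roots in $\Bbbk$. $\Bbbk\{\!\{x\}\!\}$ is the field of generalized Puiseux series: all formal power series in $x$ with coefficients in $\Bbbk$ whose support is a well-ordered subset of $\bigcup_{i\ge 0}\frac{1}{Np^i}\mathbb{Z}$ for some positive integer $N$. *)

theory Defs
  imports
    "HOL-Analysis.Analysis"
    "HOL-Computational_Algebra.Computational_Algebra"
    "HOL-Algebra.RingHom"
begin

text \<open>Exponent vectors are elements of \<open>rat ^ 'd\<close>, lattice vectors of \<open>int ^ 'd\<close> and weights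
  of \<open>real ^ 'd\<close>.\<close>

definition real_vec :: "rat ^ 'd \<Rightarrow> real ^ 'd" where
  "real_vec u = (\<chi> i. of_rat (u $ i))"

definition real_vec_int :: "int ^ 'd \<Rightarrow> real ^ 'd" where
  "real_vec_int n = (\<chi> i. of_int (n $ i))"

definition weight :: "real ^ 'd \<Rightarrow> rat ^ 'd \<Rightarrow> real" where
  "weight w u = w \<bullet> real_vec u"

definition lin_indep_vecs :: "(real ^ 'd) set" where
  "lin_indep_vecs =
    {w. \<forall>c :: 'd \<Rightarrow> rat. (\<Sum>i\<in>UNIV. of_rat (c i) * w $ i) = 0 \<longrightarrow> (\<forall>i. c i = 0)}"


subsection \<open>Cones\<close>

text \<open>The library constant \<^const>\<open>cone\<close> forces a nonempty cone to contain the origin, which would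
  exclude open cones other than the whole space; here only positive scalars are allowed, and
  cones are convex.\<close>

definition is_cone :: "'a::real_vector set \<Rightarrow> bool" where
  "is_cone C \<longleftrightarrow> convex C \<and> (\<forall>x\<in>C. \<forall>c>0. c *\<^sub>R x \<in> C)"

definition open_cone :: "'a::real_normed_vector set \<Rightarrow> bool" where
  "open_cone C \<longleftrightarrow> is_cone C \<and> open C"

definition pointed_cone :: "'a::real_normed_vector set \<Rightarrow> bool" where
  "pointed_cone C \<longleftrightarrow>
    is_cone C \<and> \<not> (\<exists>x v. v \<noteq> 0 \<and> (\<forall>t. x + t *\<^sub>R v \<in> closure C))"

definition dual_cone :: "'a::real_inner set \<Rightarrow> 'a set" where
  "dual_cone C = {x. \<forall>y\<in>C. 0 \<le> x \<bullet> y}"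


subsection \<open>p-discrete sets\<close>

definition well_ordered_by :: "('a \<Rightarrow> 'a \<Rightarrow> bool) \<Rightarrow> 'a set \<Rightarrow> bool" where
  "well_ordered_by R A \<longleftrightarrow> well_order_on A (relation_of R A)"

definition char_exponent :: "'k::field itself \<Rightarrow> nat" where
  "char_exponent _ = (if CHAR('k) = 0 then 1 else CHAR('k))"

definition frac_lattice :: "nat \<Rightarrow> nat \<Rightarrow> (rat ^ 'd) set" where
  "frac_lattice N p = (\<Union>j. {u. \<forall>i. \<exists>m::int. u $ i = of_int m / of_nat (N * p ^ j)})"

definition above :: "(rat ^ 'd) set \<Rightarrow> rat ^ 'd \<Rightarrow> real ^ 'd \<Rightarrow> (rat ^ 'd) set" where
  "above A \<gamma> w = {a \<in> A. weight w a > weight w \<gamma>}"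

definition below :: "(rat ^ 'd) set \<Rightarrow> rat ^ 'd \<Rightarrow> real ^ 'd \<Rightarrow> (rat ^ 'd) set" where
  "below A \<gamma> w = {a \<in> A. weight w a < weight w \<gamma>}"

definition p_discrete :: "nat \<Rightarrow> real ^ 'd \<Rightarrow> (rat ^ 'd) set \<Rightarrow> bool" where
  "p_discrete p w A \<longleftrightarrow>
    (\<exists>\<sigma>. open_cone \<sigma> \<and> w \<in> \<sigma> \<and>
      (\<forall>w' \<in> \<sigma> \<inter> lin_indep_vecs. well_ordered_by (\<le>) (weight w' ` A))) \<and>
    (\<exists>N>0. \<exists>\<gamma>. \<exists>C. pointed_cone C \<and> w \<in> interior (dual_cone C) \<and>
      real_vec ` A \<subseteq> (\<lambda>y. real_vec \<gamma> + y) ` C \<and> A \<subseteq> frac_lattice N p) \<and>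
    (\<forall>a :: nat \<Rightarrow> rat ^ 'd. (\<forall>i. a i \<in> A) \<longrightarrow> convergent (\<lambda>i. weight w (a i)) \<longrightarrow>
      (\<exists>q. (\<lambda>i. real_vec (a i)) \<longlonglongrightarrow> real_vec q)) \<and>
    (\<forall>\<gamma>'. \<exists>\<sigma>. open_cone \<sigma> \<and> w \<in> \<sigma> \<and>
      (\<forall>w' \<in> \<sigma> \<inter> lin_indep_vecs.
        above A \<gamma>' w' = above A \<gamma>' w \<and> below A \<gamma>' w' = below A \<gamma>' w))"


subsection \<open>Rings of formal series\<close>

definition support :: "('e \<Rightarrow> 'k::zero) \<Rightarrow> 'e set" where
  "support f = {u. f u \<noteq> 0}"

text \<open>The index set of the sum is finite whenever the supports are well ordered by a
  translation-invariant total order, as in all rings below.\<close>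

definition convolve ::
  "('e::comm_monoid_add \<Rightarrow> 'k::comm_ring_1) \<Rightarrow> ('e \<Rightarrow> 'k) \<Rightarrow> 'e \<Rightarrow> 'k" where
  "convolve f g u = (\<Sum>(a, b) \<in> {(a, b) \<in> support f \<times> support g. a + b = u}. f a * g b)"

definition series_ring ::
  "('e::comm_monoid_add \<Rightarrow> 'k::comm_ring_1) set \<Rightarrow> ('e \<Rightarrow> 'k) ring" where
  "series_ring S =
    \<lparr>carrier = S, mult = convolve, one = (\<lambda>u. if u = 0 then 1 else 0),
     zero = (\<lambda>_. 0), add = (\<lambda>f g u. f u + g u)\<rparr>"

definition K_w :: "real ^ 'd \<Rightarrow> (rat ^ 'd \<Rightarrow> 'k::field) ring" where
  "K_w w = series_ring {f. p_discrete (char_exponent TYPE('k)) w (support f)}"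

definition K_C :: "real ^ 'd \<Rightarrow> (real ^ 'd) set \<Rightarrow> (rat ^ 'd \<Rightarrow> 'k::field) ring" where
  "K_C w C = (K_w w)
    \<lparr>carrier := {f \<in> carrier (K_w w).
      (\<forall>w' \<in> C \<inter> lin_indep_vecs.
        well_ordered_by (\<lambda>u v. weight w' u \<le> weight w' v) (support f)) \<and>
      support f \<subseteq> frac_lattice 1 (char_exponent TYPE('k))}\<rparr>"

definition gen_puiseux :: "(rat \<Rightarrow> 'k::field) ring" where
  "gen_puiseux = series_ring
    {f. well_ordered_by (\<le>) (support f) \<and>
      (\<exists>N>0. support f \<subseteq>
        (\<Union>i. {q. \<exists>m::int. q = of_int m / of_nat (N * char_exponent TYPE('k) ^ i)}))}"


subsection \<open>The specialization map\<close>

text \<open>For \<open>u = m / p ^ j\<close>, the power \<open>t\<^sup>u\<close> is \<open>r\<^sup>m\<close>, where \<open>r\<close> is the unique \<open>p ^ j\<close>-th root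
  of \<open>t\<close>; \<open>frac_pow_eq\<close> below shows that this does not depend on the representation of \<open>u\<close>.\<close>

definition frac_pow :: "'k::field \<Rightarrow> rat \<Rightarrow> 'k" where
  "frac_pow t u = (THE y. \<exists>(m::int) j r. u = of_int m / of_nat (char_exponent TYPE('k) ^ j) \<and>
     r ^ (char_exponent TYPE('k) ^ j) = t \<and> y = r powi m)"

definition vec_pow :: "'k::field ^ 'd \<Rightarrow> rat ^ 'd \<Rightarrow> 'k" where
  "vec_pow \<theta> u = (\<Prod>i\<in>UNIV. frac_pow (\<theta> $ i) (u $ i))"

definition int_dot :: "int ^ 'd \<Rightarrow> rat ^ 'd \<Rightarrow> rat" where
  "int_dot n u = (\<Sum>i\<in>UNIV. of_int (n $ i) * u $ i)"

definition specialize ::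
  "'k::field ^ 'd \<Rightarrow> int ^ 'd \<Rightarrow> (rat ^ 'd \<Rightarrow> 'k) \<Rightarrow> rat \<Rightarrow> 'k" where
  "specialize \<theta> n f s = (\<Sum>u \<in> {u \<in> support f. int_dot n u = s}. f u * vec_pow \<theta> u)"

lemma char_exponent_pos: "char_exponent TYPE('k::field) > 0"
  by (simp add: char_exponent_def)

lemma char_exponent_root_unique:
  fixes x y :: "'k::field"
  assumes "x ^ (char_exponent TYPE('k) ^ j) = y ^ (char_exponent TYPE('k) ^ j)"
  shows "x = y"
proof (cases "CHAR('k) = 0")
  case True
  then show ?thesis using assms by (simp add: char_exponent_def)
next
  case False
  then have p: "prime CHAR('k)" by (simp add: prime_CHAR_semidom)
  have "((x - y) + y) ^ (CHAR('k) ^ j) = (x - y) ^ (CHAR('k) ^ j) + y ^ (CHAR('k) ^ j)"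
    using freshmans_dream'[OF p refl, of "x - y" y j] by simp
  then have "(x - y) ^ (CHAR('k) ^ j) = 0"
    using assms False by (simp add: char_exponent_def)
  then show ?thesis by simp
qed

lemma char_exponent_root_exists:
  fixes t :: "'k::alg_closed_field"
  shows "\<exists>r. r ^ (char_exponent TYPE('k) ^ j) = t"
  using nth_root_exists[of "char_exponent TYPE('k) ^ j" t] char_exponent_pos[where 'k = 'k]
  by auto

lemma frac_pow_eq:
  fixes t r :: "'k::field"
  assumes "t \<noteq> 0" and r: "r ^ (char_exponent TYPE('k) ^ j) = t"
  shows "frac_pow t (of_int m / of_nat (char_exponent TYPE('k) ^ j)) = r powi m"
proof -
  define p where "p = char_exponent TYPE('k)"
  have p0: "p > 0" using char_exponent_pos[where 'k = 'k] by (simp add: p_def)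
  have "s powi m' = r powi m"
    if eq: "(of_int m :: rat) / of_nat (p ^ j) = of_int m' / of_nat (p ^ j')"
      and s: "s ^ (p ^ j') = t" for m' j' s
  proof -
    have "(of_int (m * int (p ^ j')) :: rat) = of_int (m' * int (p ^ j))"
      using eq p0 by (simp add: field_simps)
    then have e: "m * int (p ^ j') = m' * int (p ^ j)" by (simp only: of_int_eq_iff)
    have "(s powi m') ^ (p ^ (j' + j)) = (s ^ (p ^ j')) powi (m' * int (p ^ j))"
      by (simp add: power_add mult_ac flip: power_int_of_nat power_int_mult)
    also have "\<dots> = (r ^ (p ^ j)) powi (m * int (p ^ j'))"
      using r s e by (simp add: p_def)
    also have "\<dots> = (r powi m) ^ (p ^ (j' + j))"
      by (simp add: power_add mult_ac flip: power_int_of_nat power_int_mult)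
    finally show ?thesis unfolding p_def by (rule char_exponent_root_unique)
  qed
  then show ?thesis
    using r unfolding frac_pow_def p_def[symmetric] by (intro the_equality) blast+
qed

end

theory Submission
  imports Defs
begin

text \<open>A set is well ordered by a weight iff each of its sequences has a subsequence of increasing
  weight, a form which passes to unions and sumsets by extracting subsequences. For a sequence in a
  sumset whose weights are bounded above, both summands may be taken with increasing weights; they
  then converge to rational points lying weakly above them. This gives convergence of sequences in
  sumsets and, applied to hypothetical violations at weight vectors tending to \<open>w\<close>, the stability
  of the two sides of any \<open>\<gamma>\<close>. So \<open>p\<close>-discrete supports form rings.

  Although \<open>n\<close> is not linearly independent over the rationals, \<open>2 n = (n + \<epsilon> w) + (n - \<epsilon> w)\<close>, where
  both summands are in \<open>C\<close> and linearly independent for suitable \<open>\<epsilon>\<close>. Along sequences increasing for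
  both, \<open>n\<close> is increasing, and if \<open>n\<close> is constant then so are both; hence the support has well
  ordered image and finite fibres. Convolution and specialization are both sums over fibres, and
  multiplicativity is the compatibility of such sums with composition.\<close>


subsection \<open>Well orders and increasing subsequences\<close>

text \<open>Sequential form of the statement that the image of \<open>A\<close> under
  \<open>\<phi>\<close> is well ordered. The increase is only weak, so constant subsequences count
  and the fibres of \<open>\<phi>\<close> are unrestricted.\<close>

definition wo_under :: "('a \<Rightarrow> 'b::linorder) \<Rightarrow> 'a set \<Rightarrow> bool" where
  "wo_under \<phi> A \<longleftrightarrow>
    (\<forall>x::nat \<Rightarrow> 'a. (\<forall>i. x i \<in> A) \<longrightarrow> (\<exists>r. strict_mono r \<and> incseq (\<lambda>i. \<phi> (x (r i)))))"

lemma wo_underE: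
  assumes "wo_under \<phi> A" and "\<And>i::nat. x i \<in> A"
  obtains r where "strict_mono r" and "incseq (\<lambda>i. \<phi> (x (r i)))"
  using assms unfolding wo_under_def by blast

text \<open>Injectivity makes the comparison of values antisymmetric on \<open>A\<close>. Every
  sequence has a monotone subsequence, and in a well order a decreasing one becomes constant;
  conversely, an infinite strictly descending chain has no increasing subsequence.\<close>

lemma well_ordered_by_iff_wo_under:
  fixes \<phi> :: "'a \<Rightarrow> 'b::linorder"
  assumes inj: "inj_on \<phi> A"
  shows "well_ordered_by (\<lambda>u v. \<phi> u \<le> \<phi> v) A \<longleftrightarrow> wo_under \<phi> A"
proof
  let ?r = "relation_of (\<lambda>u v. \<phi> u \<le> \<phi> v) A"
  assume "well_ordered_by (\<lambda>u v. \<phi> u \<le> \<phi> v) A"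
  then have wf: "wf (?r - Id)"
    by (simp add: well_ordered_by_def well_order_on_def)
  show "wo_under \<phi> A" unfolding wo_under_def
  proof (intro allI impI)
    fix x :: "nat \<Rightarrow> 'a" assume xA: "\<forall>i. x i \<in> A"
    obtain r where r: "strict_mono r" and mono: "monoseq (\<lambda>i. \<phi> (x (r i)))"
      using seq_monosub[of "\<lambda>i. \<phi> (x i)"] by blast
    from mono consider "incseq (\<lambda>i. \<phi> (x (r i)))" | "decseq (\<lambda>i. \<phi> (x (r i)))"
      by (auto simp: monoseq_iff)
    then show "\<exists>r. strict_mono r \<and> incseq (\<lambda>i. \<phi> (x (r i)))"
    proof cases
      case 1
      with r show ?thesis by blast
    next
      case 2
      obtain z where z: "z \<in> range (\<lambda>i. x (r i))"
        and min: "\<And>y. (y, z) \<in> ?r - Id \<Longrightarrow> y \<notin> range (\<lambda>i. x (r i))"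
        using wfE_min[OF wf, of "x (r 0)" "range (\<lambda>i. x (r i))"] by blast
      from z obtain k where k: "z = x (r k)" by blast
      \<comment> \<open>From index \<open>k\<close> on the decreasing sequence cannot leave its
        minimum \<open>z\<close>, so this tail is constant and counts as increasing.\<close>
      have eq: "x (r (i + k)) = x (r k)" for i
      proof (rule ccontr)
        assume "x (r (i + k)) \<noteq> x (r k)"
        moreover have "\<phi> (x (r (i + k))) \<le> \<phi> (x (r k))"
          using decseqD[OF 2, of k "i + k"] by simp
        ultimately have "(x (r (i + k)), z) \<in> ?r - Id"
          using xA k by (auto simp: relation_of_def)
        then show False using min by blast
      qed
      have "strict_mono (\<lambda>i. r (i + k))" using r by (simp add: strict_mono_def)
      moreover have "incseq (\<lambda>i. \<phi> (x (r (i + k))))" by (simp add: eq)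
      ultimately show ?thesis by blast
    qed
  qed
next
  let ?r = "relation_of (\<lambda>u v. \<phi> u \<le> \<phi> v) A"
  assume wo: "wo_under \<phi> A"
  have "linear_order_on A ?r"
    unfolding order_on_defs refl_on_def trans_def antisym_def total_on_def relation_of_def
    using inj by (fastforce dest: inj_onD)
  moreover have "wf (?r - Id)"
    unfolding wf_iff_no_infinite_down_chain
  proof
    assume "\<exists>f. \<forall>i. (f (Suc i), f i) \<in> ?r - Id"
    then obtain f :: "nat \<Rightarrow> 'a" where f: "\<And>i. (f (Suc i), f i) \<in> ?r - Id" by blast
    have fA: "f i \<in> A" for i using f[of i] by (auto simp: relation_of_def)
    have "\<phi> (f (Suc i)) < \<phi> (f i)" for i
      using f[of i] inj by (fastforce simp: relation_of_def less_le dest: inj_onD)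
    then have dec: "i < j \<Longrightarrow> \<phi> (f j) < \<phi> (f i)" for i j
      by (induction j) (auto simp: less_Suc_eq intro: less_trans)
    obtain r where r: "strict_mono r" and inc: "incseq (\<lambda>i. \<phi> (f (r i)))"
      using wo_underE[OF wo fA] .
    have "r 0 < r 1" using r by (simp add: strict_mono_def)
    with dec[of "r 0" "r 1"] incseqD[OF inc, of 0 1] show False by simp
  qed
  ultimately show "well_ordered_by (\<lambda>u v. \<phi> u \<le> \<phi> v) A"
    by (simp add: well_ordered_by_def well_order_on_def)
qed

lemma wo_under_subset: "wo_under \<phi> A \<Longrightarrow> B \<subseteq> A \<Longrightarrow> wo_under \<phi> B"
  unfolding wo_under_def by blast

lemma wo_under_image: "wo_under \<phi> (f ` A) \<longleftrightarrow> wo_under (\<lambda>x. \<phi> (f x)) A"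
proof
  assume "wo_under \<phi> (f ` A)"
  then show "wo_under (\<lambda>x. \<phi> (f x)) A"
    unfolding wo_under_def by (intro allI impI) (drule spec, drule mp, rule allI, rule imageI, auto)
next
  assume wo: "wo_under (\<lambda>x. \<phi> (f x)) A"
  show "wo_under \<phi> (f ` A)" unfolding wo_under_def
  proof (intro allI impI)
    fix x :: "nat \<Rightarrow> _" assume "\<forall>i. x i \<in> f ` A"
    then have "\<forall>i. \<exists>y\<in>A. x i = f y" by blast
    then obtain y where y: "\<And>i. y i \<in> A" and x: "\<And>i. x i = f (y i)" by metis
    obtain r where "strict_mono r" "incseq (\<lambda>i. \<phi> (f (y (r i))))" using wo_underE[OF wo y] .
    then show "\<exists>r. strict_mono r \<and> incseq (\<lambda>i. \<phi> (x (r i)))" unfolding x by blast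
  qed
qed

text \<open>The identity is injective on the image, so the preceding equivalence applies there for
  arbitrary \<open>\<phi>\<close>.\<close>

lemma well_ordered_by_image: "well_ordered_by (\<le>) (\<phi> ` A) \<longleftrightarrow> wo_under \<phi> A"
  using well_ordered_by_iff_wo_under[of "\<lambda>x. x" "\<phi> ` A"] wo_under_image[of "\<lambda>x. x" \<phi> A]
  by simp

text \<open>Pigeonhole: one of the two index sets is infinite, and its enumeration is the
  subsequence.\<close>

lemma subseq_disjE:
  assumes "\<And>i::nat. P i \<or> Q i"
  obtains (left) r :: "nat \<Rightarrow> nat" where "strict_mono r" and "\<forall>i. P (r i)"
    | (right) r :: "nat \<Rightarrow> nat" where "strict_mono r" and "\<forall>i. Q (r i)"
proof (cases "infinite {i. P i}")
  case True
  then show ?thesis using infinite_enumerate[of "{i. P i}"] that(1) by auto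
next
  case False
  moreover have "{i. P i} \<union> {i. Q i} = UNIV" using assms by blast
  ultimately have "infinite {i. Q i}" by (metis finite_Un infinite_UNIV_nat)
  then show ?thesis using infinite_enumerate[of "{i. Q i}"] that(2) by auto
qed

lemma wo_under_Un:
  fixes A B :: "'a set"
  assumes A: "wo_under \<phi> A" and B: "wo_under \<phi> B"
  shows "wo_under \<phi> (A \<union> B)"
  unfolding wo_under_def
proof (intro allI impI)
  fix x :: "nat \<Rightarrow> 'a" assume "\<forall>i. x i \<in> A \<union> B"
  then have "x i \<in> A \<or> x i \<in> B" for i by blast
  then obtain r :: "nat \<Rightarrow> nat" and D where r: "strict_mono r"
    and D: "wo_under \<phi> D" "\<And>i. x (r i) \<in> D"
    by (rule subseq_disjE[of "\<lambda>i. x i \<in> A" "\<lambda>i. x i \<in> B"]) (use A B in blast)+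
  obtain s where "strict_mono s" "incseq (\<lambda>i. \<phi> (x (r (s i))))"
    using wo_underE[OF D] .
  with strict_mono_o[OF r] show "\<exists>r. strict_mono r \<and> incseq (\<lambda>i. \<phi> (x (r i)))"
    by (intro exI[of _ "\<lambda>i. r (s i)"]) (simp add: o_def)
qed

text \<open>The second extraction is made along the first, and increase survives it. This serves
  both two summands under one weight and one sequence under two weights.\<close>

lemma wo_under_pairE:
  assumes A: "wo_under \<phi> A" and B: "wo_under \<psi> B"
    and x: "\<And>i::nat. x i \<in> A" and y: "\<And>i. y i \<in> B"
  obtains r where "strict_mono r" "incseq (\<lambda>i. \<phi> (x (r i)))" "incseq (\<lambda>i. \<psi> (y (r i)))"
proof -
  obtain r where r: "strict_mono r" "incseq (\<lambda>i. \<phi> (x (r i)))" using wo_underE[OF A x] .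
  obtain s where s: "strict_mono s" "incseq (\<lambda>i. \<psi> (y (r (s i))))"
    using wo_underE[OF B, of "\<lambda>i. y (r i)"] y by blast
  have "incseq (\<lambda>i. \<phi> (x (r (s i))))"
    using r(2) s(1) by (auto simp: incseq_def strict_mono_less_eq)
  then show thesis
    using that[of "\<lambda>i. r (s i)"] strict_mono_o[OF r(1) s(1)] s(2) by (simp add: o_def)
qed

lemma wo_under_sumset:
  fixes \<phi> :: "'a::comm_monoid_add \<Rightarrow> 'b::linordered_ab_group_add"
  assumes A: "wo_under \<phi> A" and B: "wo_under \<phi> B"
    and add: "\<And>a b. \<phi> (a + b) = \<phi> a + \<phi> b"
  shows "wo_under \<phi> ((\<lambda>(a, b). a + b) ` (A \<times> B))"
  unfolding wo_under_def
proof (intro allI impI)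
  fix x :: "nat \<Rightarrow> _" assume "\<forall>i. x i \<in> (\<lambda>(a, b). a + b) ` (A \<times> B)"
  then have "\<forall>i. \<exists>a b. a \<in> A \<and> b \<in> B \<and> x i = a + b" by fast
  then obtain a b where a: "\<And>i. a i \<in> A" and b: "\<And>i. b i \<in> B" and x: "\<And>i. x i = a i + b i"
    by metis
  obtain r where "strict_mono r" "incseq (\<lambda>i. \<phi> (a (r i)))" "incseq (\<lambda>i. \<phi> (b (r i)))"
    using wo_under_pairE[OF A B a b] .
  then show "\<exists>r. strict_mono r \<and> incseq (\<lambda>i. \<phi> (x (r i)))"
    by (intro exI[of _ r]) (auto simp: x add incseq_def intro: add_mono)
qed

lemma incseq_sum_const_imp_const:
  fixes f g :: "nat \<Rightarrow> 'a::linordered_ab_group_add"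
  assumes "incseq f" "incseq g" and "\<And>i. f i + g i = c"
  shows "f i = f 0" "g i = g 0"
proof -
  have "f 0 \<le> f i" "g 0 \<le> g i" using assms(1,2) by (auto simp: incseq_def)
  moreover have "f i + g i = f 0 + g 0" using assms(3) by simp
  ultimately show "f i = f 0" "g i = g 0"
    by (metis add_le_imp_le_left add_le_imp_le_right add_left_mono add_right_mono order_antisym)+
qed

text \<open>An injective sequence in \<open>A\<close> would have a subsequence along which both
  functions increase. A constant sum forces both to be constant there, against the injectivity of
  \<open>\<phi>\<close>.\<close>

lemma finite_if_wo_under_sum_const:
  fixes \<phi> \<psi> :: "'a \<Rightarrow> 'b::linordered_ab_group_add"
  assumes "wo_under \<phi> A" and "wo_under \<psi> A" and "inj_on \<phi> A"
    and const: "\<And>a. a \<in> A \<Longrightarrow> \<phi> a + \<psi> a = c"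
  shows "finite A"
proof (rule ccontr)
  assume "infinite A"
  then obtain x :: "nat \<Rightarrow> 'a" where x: "inj x" "range x \<subseteq> A"
    using infinite_countable_subset by blast
  then have xA: "x i \<in> A" for i by blast
  obtain r where r: "strict_mono r" "incseq (\<lambda>i. \<phi> (x (r i)))" "incseq (\<lambda>i. \<psi> (x (r i)))"
    using wo_under_pairE[OF assms(1,2) xA xA] .
  have "\<phi> (x (r 1)) = \<phi> (x (r 0))"
    using incseq_sum_const_imp_const(1)[OF r(2,3)] const[OF xA] by blast
  then have "r 1 = r 0" using assms(3) x xA by (metis inj_onD injD)
  then show False using r(1) by (simp add: strict_mono_eq)
qed

text \<open>On the pairs with sum \<open>u\<close>, the values of \<open>\<phi>\<close> on the two
  components add up to \<open>\<phi> u\<close>, so the preceding criterion applies to the two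
  projections.\<close>

lemma finite_sumset_fibre:
  fixes \<phi> :: "'a::comm_monoid_add \<Rightarrow> 'b::linordered_ab_group_add"
  assumes A: "wo_under \<phi> A" and B: "wo_under \<phi> B" and inj: "inj \<phi>"
    and add: "\<And>a b. \<phi> (a + b) = \<phi> a + \<phi> b"
  shows "finite {(a, b) \<in> A \<times> B. a + b = u}" (is "finite ?S")
proof (rule finite_if_wo_under_sum_const)
  show "wo_under (\<lambda>x. \<phi> (fst x)) ?S"
    unfolding wo_under_image[symmetric] by (rule wo_under_subset[OF A]) auto
  show "wo_under (\<lambda>x. \<phi> (snd x)) ?S"
    unfolding wo_under_image[symmetric] by (rule wo_under_subset[OF B]) auto
  show "\<phi> (fst x) + \<phi> (snd x) = \<phi> u" if "x \<in> ?S" for x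
    using that by (auto simp flip: add)
  show "inj_on (\<lambda>x. \<phi> (fst x)) ?S"
  proof (rule inj_onI)
    fix x y assume x: "x \<in> ?S" and y: "y \<in> ?S" and eq: "\<phi> (fst x) = \<phi> (fst y)"
    have "\<phi> (fst x) + \<phi> (snd x) = \<phi> (fst y) + \<phi> (snd y)"
      using x y by (auto simp flip: add)
    then have "\<phi> (snd x) = \<phi> (snd y)" using eq by simp
    with eq inj show "x = y" by (simp add: prod_eq_iff inj_eq)
  qed
qed


subsection \<open>Sums over fibres and rings of series\<close>

text \<open>Pushforward of a formal series along a map of exponents. An infinite index set would
  make \<open>sum\<close> return 0, hence the finiteness hypotheses in what follows.\<close>

definition push :: "('a \<Rightarrow> 'b) \<Rightarrow> ('a \<Rightarrow> 'k::comm_monoid_add) \<Rightarrow> 'b \<Rightarrow> 'k" where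
  "push \<phi> F s = sum F {u. F u \<noteq> 0 \<and> \<phi> u = s}"

text \<open>Product of two series in separate variables. Its pushforward under addition is the
  convolution.\<close>

definition tensor :: "('a \<Rightarrow> 'k::times) \<Rightarrow> ('b \<Rightarrow> 'k) \<Rightarrow> 'a \<times> 'b \<Rightarrow> 'k" where
  "tensor f g = (\<lambda>(a, b). f a * g b)"

text \<open>The sum may run over any finite part of the fibre that contains its nonzero terms, which
  allows different series to be summed over one index set.\<close>

lemma push_eq_sum:
  assumes "finite S" and "\<And>u. u \<in> S \<Longrightarrow> \<phi> u = s" and "\<And>u. F u \<noteq> 0 \<Longrightarrow> \<phi> u = s \<Longrightarrow> u \<in> S"
  shows "push \<phi> F s = sum F S"
  unfolding push_def using assms by (intro sum.mono_neutral_left) auto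

lemma support_push: "support (push \<phi> F) \<subseteq> \<phi> ` support F"
proof
  fix s assume "s \<in> support (push \<phi> F)"
  then have "push \<phi> F s \<noteq> 0" by (simp add: support_def)
  then have "{u. F u \<noteq> 0 \<and> \<phi> u = s} \<noteq> {}" unfolding push_def by (metis sum.empty)
  then show "s \<in> \<phi> ` support F" by (auto simp: support_def)
qed

lemma support_tensor: "support (tensor f g) \<subseteq> support f \<times> support (g :: 'b \<Rightarrow> 'k::mult_zero)"
  by (auto simp: support_def tensor_def)

text \<open>Functoriality of the pushforward: the terms over \<open>s\<close> are grouped by their
  intermediate value. A fibre of \<open>\<phi>\<close> over such a value lies in the fibre of the
  composite, so it is finite as well.\<close>

lemma push_push:
  assumes fin: "finite {u \<in> support F. \<psi> (\<phi> u) = s}"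
  shows "push \<psi> (push \<phi> F) s = push (\<lambda>u. \<psi> (\<phi> u)) F s"
proof -
  let ?S = "{u \<in> support F. \<psi> (\<phi> u) = s}"
  have "push \<psi> (push \<phi> F) s = sum (push \<phi> F) (\<phi> ` ?S)"
    using support_push[of \<phi> F] fin by (intro push_eq_sum) (auto simp: support_def)
  also have "\<dots> = (\<Sum>t\<in>\<phi> ` ?S. sum F {u. u \<in> ?S \<and> \<phi> u = t})"
    by (intro sum.cong refl push_eq_sum finite_subset[OF _ fin]) (auto simp: support_def)
  also have "\<dots> = sum F ?S"
    using fin by (intro sum.group) auto
  also have "\<dots> = push (\<lambda>u. \<psi> (\<phi> u)) F s"
    using fin by (intro push_eq_sum[symmetric]) (auto simp: support_def)
  finally show ?thesis .
qed

text \<open>Cancellation may shrink the support of the sum, so all three sums are taken over the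
  union of the two fibres.\<close>

lemma push_add:
  assumes "finite {u \<in> support F. \<phi> u = s}" and "finite {u \<in> support G. \<phi> u = s}"
  shows "push \<phi> (\<lambda>u. F u + G u) s = push \<phi> F s + push \<phi> G s"
proof -
  let ?S = "{u \<in> support F. \<phi> u = s} \<union> {u \<in> support G. \<phi> u = s}"
  have fin: "finite ?S" using assms by blast
  have "push \<phi> (\<lambda>u. F u + G u) s = (\<Sum>u\<in>?S. F u + G u)"
    using fin by (intro push_eq_sum) (auto simp: support_def)
  moreover have "push \<phi> F s = sum F ?S" "push \<phi> G s = sum G ?S"
    using fin by (auto intro!: push_eq_sum simp: support_def)
  ultimately show ?thesis by (simp add: sum.distrib)
qed

text \<open>Swapping a pair gives commutativity of convolution, and rotating a triple gives
  associativity.\<close>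

lemma push_reindex:
  assumes "bij h" and "\<And>u. \<psi> (h u) = \<phi> u" and "\<And>u. G (h u) = F u"
  shows "push \<phi> F s = push \<psi> G s"
proof -
  have "bij_betw h {u. F u \<noteq> 0 \<and> \<phi> u = s} {u. G u \<noteq> 0 \<and> \<psi> u = s}"
  proof (rule bij_betw_imageI)
    show "inj_on h {u. F u \<noteq> 0 \<and> \<phi> u = s}"
      using assms(1) by (meson bij_is_inj inj_on_subset subset_UNIV)
    show "h ` {u. F u \<noteq> 0 \<and> \<phi> u = s} = {u. G u \<noteq> 0 \<and> \<psi> u = s}"
    proof (rule equalityI; rule subsetI)
      fix v assume v: "v \<in> {u. G u \<noteq> 0 \<and> \<psi> u = s}"
      obtain u where "v = h u" using assms(1) by (metis bij_pointE)
      with v assms(2,3) show "v \<in> h ` {u. F u \<noteq> 0 \<and> \<phi> u = s}" by auto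
    qed (use assms(2,3) in auto)
  qed
  from sum.reindex_bij_betw[OF this, of G] show ?thesis by (simp add: push_def assms(3))
qed

text \<open>A field has no zero divisors, so the index set for the pair \<open>(s, t)\<close> is
  exactly the product of the two index sets.\<close>

lemma tensor_push:
  fixes f :: "'a \<Rightarrow> 'k::field" and g :: "'b \<Rightarrow> 'k"
  shows "tensor (push \<phi> f) (push \<psi> g) = push (map_prod \<phi> \<psi>) (tensor f g)"
proof (rule ext, clarify)
  fix s t
  have "{u. tensor f g u \<noteq> 0 \<and> map_prod \<phi> \<psi> u = (s, t)}
      = {u. f u \<noteq> 0 \<and> \<phi> u = s} \<times> {v. g v \<noteq> 0 \<and> \<psi> v = t}"
    by (auto simp: tensor_def)
  then show "tensor (push \<phi> f) (push \<psi> g) (s, t) = push (map_prod \<phi> \<psi>) (tensor f g) (s, t)"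
    by (simp add: push_def tensor_def sum_product sum.cartesian_product)
qed

lemma push_id: "push (\<lambda>u. u) f = f"
proof
  show "push (\<lambda>u. u) f s = f s" for s
    using push_eq_sum[of "{s}" "\<lambda>u. u" s f] by simp
qed

section \<open>Convolution as a pushforward\<close>

lemma convolve_eq_push:
  fixes f g :: "'e::comm_monoid_add \<Rightarrow> 'k::field"
  shows "convolve f g = push (\<lambda>(a, b). a + b) (tensor f g)"
  unfolding convolve_def push_def tensor_def support_def
  by (intro ext sum.cong) auto

lemma support_convolve:
  fixes f g :: "'e::comm_monoid_add \<Rightarrow> 'k::field"
  shows "support (convolve f g) \<subseteq> (\<lambda>(a, b). a + b) ` (support f \<times> support g)"
  unfolding convolve_eq_push using support_push support_tensor by fast

lemma convolve_commute:
  fixes f g :: "'e::comm_monoid_add \<Rightarrow> 'k::field"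
  shows "convolve f g = convolve g f"
  unfolding convolve_eq_push
  by (intro ext push_reindex[where h = prod.swap]) (auto simp: tensor_def add.commute)

lemma convolve_add_left:
  fixes f g h :: "'e::comm_monoid_add \<Rightarrow> 'k::field"
  assumes "finite {(a, b) \<in> support f \<times> support h. a + b = u}"
    and "finite {(a, b) \<in> support g \<times> support h. a + b = u}"
  shows "convolve (\<lambda>u. f u + g u) h u = convolve f h u + convolve g h u"
proof -
  have "tensor (\<lambda>u. f u + g u) h = (\<lambda>x. tensor f h x + tensor g h x)"
    by (auto simp: tensor_def algebra_simps)
  moreover have "finite {x \<in> support (tensor f h). (\<lambda>(a, b). a + b) x = u}"
    by (rule finite_subset[OF _ assms(1)]) (use support_tensor in auto)
  moreover have "finite {x \<in> support (tensor g h). (\<lambda>(a, b). a + b) x = u}"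
    by (rule finite_subset[OF _ assms(2)]) (use support_tensor in auto)
  ultimately show ?thesis by (simp add: convolve_eq_push push_add)
qed

lemma convolve_one:
  fixes f :: "'e::comm_monoid_add \<Rightarrow> 'k::field"
  shows "convolve (\<lambda>u. if u = 0 then 1 else 0) f = f"
proof
  fix u
  have "convolve (\<lambda>u. if u = 0 then 1 else 0) f u
      = sum (tensor (\<lambda>u. if u = 0 then 1 else 0) f) {(0 :: 'e, u)}"
    unfolding convolve_eq_push by (rule push_eq_sum) (auto simp: tensor_def split: if_splits)
  then show "convolve (\<lambda>u. if u = 0 then 1 else 0) f u = f u" by (simp add: tensor_def)
qed

text \<open>There are finitely many choices of the partial sum \<open>x = a + b\<close> together
  with \<open>c\<close>, and each \<open>x\<close> splits in finitely many ways.\<close>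

lemma finite_triple_fibre:
  fixes A B C :: "'e::comm_monoid_add set"
  assumes AB: "\<And>u. finite {(a, b) \<in> A \<times> B. a + b = u}"
    and ABC: "finite {(x, c) \<in> ((\<lambda>(a, b). a + b) ` (A \<times> B)) \<times> C. x + c = u}" (is "finite ?T")
  shows "finite {((a, b), c) \<in> (A \<times> B) \<times> C. a + b + c = u}" (is "finite ?S")
proof (rule finite_subset)
  show "?S \<subseteq> (\<Union>(x, c)\<in>?T. {(a, b) \<in> A \<times> B. a + b = x} \<times> {c})" by fastforce
  show "finite (\<Union>(x, c)\<in>?T. {(a, b) \<in> A \<times> B. a + b = x} \<times> {c})"
    using ABC AB by (intro finite_UN_I) auto
qed

text \<open>Writing \<open>h\<close> as its pushforward under the identity lets
  \<open>tensor_push\<close> and \<open>push_push\<close> merge the two convolutions into one sum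
  over triples.\<close>

lemma convolve_convolve:
  fixes f g h :: "'e::comm_monoid_add \<Rightarrow> 'k::field"
  assumes "finite {((a, b), c) \<in> (support f \<times> support g) \<times> support h. a + b + c = u}"
  shows "convolve (convolve f g) h u
    = push (\<lambda>((a, b), c). a + b + c) (tensor (tensor f g) h) u"
proof -
  have "convolve (convolve f g) h u
      = push (\<lambda>(a, b). a + b) (tensor (push (\<lambda>(a, b). a + b) (tensor f g)) (push (\<lambda>u. u) h)) u"
    by (simp add: convolve_eq_push push_id)
  also have "\<dots> = push (\<lambda>x. (\<lambda>(a, b). a + b) (map_prod (\<lambda>(a, b). a + b) (\<lambda>u. u) x))
      (tensor (tensor f g) h) u"
    unfolding tensor_push
    by (rule push_push, rule finite_subset[OF _ assms]) (auto simp: support_def tensor_def)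
  also have "(\<lambda>x. (\<lambda>(a, b). a + b) (map_prod (\<lambda>(a, b). a + b) (\<lambda>u. u) x))
      = (\<lambda>((a, b), c). a + b + c :: 'e)" by auto
  finally show ?thesis .
qed

text \<open>Common criterion for both series rings: the ring axioms reduce to closure properties of
  the admissible supports and finiteness of the convolution sums.\<close>

lemma cring_series_ring:
  fixes P :: "'e::comm_monoid_add set \<Rightarrow> bool"
  assumes P_mono: "\<And>A B. P A \<Longrightarrow> B \<subseteq> A \<Longrightarrow> P B"
    and P_Un: "\<And>A B. P A \<Longrightarrow> P B \<Longrightarrow> P (A \<union> B)"
    and P_sum: "\<And>A B. P A \<Longrightarrow> P B \<Longrightarrow> P ((\<lambda>(a, b). a + b) ` (A \<times> B))"
    and P_zero: "P {0}"
    and fin: "\<And>A B u. P A \<Longrightarrow> P B \<Longrightarrow> finite {(a, b) \<in> A \<times> B. a + b = u}"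
  shows "cring (series_ring {f :: 'e \<Rightarrow> 'k::field. P (support f)})"
proof (rule cringI)
  let ?R = "series_ring {f :: 'e \<Rightarrow> 'k. P (support f)}"
  have conv: "P (support (convolve f g))" if "P (support f)" "P (support g)" for f g :: "'e \<Rightarrow> 'k"
    using P_mono[OF P_sum[OF that]] support_convolve by blast
  show "abelian_group ?R"
  proof (rule abelian_groupI)
    show "x \<oplus>\<^bsub>?R\<^esub> y \<in> carrier ?R" if "x \<in> carrier ?R" "y \<in> carrier ?R" for x y
      using that P_mono[OF P_Un[of "support x" "support y"], of "support (\<lambda>u. x u + y u)"]
      by (force simp: series_ring_def support_def)
    show "\<zero>\<^bsub>?R\<^esub> \<in> carrier ?R"
      using P_mono[OF P_zero, of "{}"] by (simp add: series_ring_def support_def)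
    show "\<exists>y\<in>carrier ?R. y \<oplus>\<^bsub>?R\<^esub> x = \<zero>\<^bsub>?R\<^esub>" if "x \<in> carrier ?R" for x
      using that by (intro bexI[of _ "\<lambda>u. - x u"]) (auto simp: series_ring_def support_def)
  qed (auto simp: series_ring_def add_ac)
  show "comm_monoid ?R"
  proof (rule comm_monoidI)
    show "\<one>\<^bsub>?R\<^esub> \<in> carrier ?R"
      using P_zero by (simp add: series_ring_def support_def)
    show "(f \<otimes>\<^bsub>?R\<^esub> g) \<otimes>\<^bsub>?R\<^esub> h = f \<otimes>\<^bsub>?R\<^esub> (g \<otimes>\<^bsub>?R\<^esub> h)"
      if "f \<in> carrier ?R" "g \<in> carrier ?R" "h \<in> carrier ?R" for f g h
    proof -
      have f: "P (support f)" and g: "P (support g)" and h: "P (support h)"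
        using that by (auto simp: series_ring_def)
      \<comment> \<open>Each side is a sum over triples, and a cyclic rotation matches the two.
        Commutativity then moves \<open>f\<close> back to the front.\<close>
      have "convolve (convolve f g) h u = convolve (convolve g h) f u" for u
      proof -
        have "convolve (convolve f g) h u
            = push (\<lambda>((a, b), c). a + b + c) (tensor (tensor f g) h) u"
          using f g h by (intro convolve_convolve finite_triple_fibre fin P_sum)
        also have "\<dots> = push (\<lambda>((a, b), c). a + b + c) (tensor (tensor g h) f) u"
          by (rule push_reindex[where h = "\<lambda>((a, b), c). ((b, c), a)"])
            (auto simp: tensor_def add_ac mult_ac
              intro!: o_bij[where g = "\<lambda>((b, c), a). ((a, b), c)"])
        also have "\<dots> = convolve (convolve g h) f u"
          using f g h by (intro convolve_convolve[symmetric] finite_triple_fibre fin P_sum)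
        finally show ?thesis .
      qed
      then show ?thesis by (auto simp: series_ring_def convolve_commute[of f])
    qed
  qed (auto simp: series_ring_def conv convolve_one intro: convolve_commute)
  show "(f \<oplus>\<^bsub>?R\<^esub> g) \<otimes>\<^bsub>?R\<^esub> h = f \<otimes>\<^bsub>?R\<^esub> h \<oplus>\<^bsub>?R\<^esub> g \<otimes>\<^bsub>?R\<^esub> h"
    if "f \<in> carrier ?R" "g \<in> carrier ?R" "h \<in> carrier ?R" for f g h
    using that by (auto simp: series_ring_def intro!: convolve_add_left fin)
qed


subsection \<open>Weights, denominators and conditions for p-discreteness\<close>

lemma real_vec_zero [simp]: "real_vec 0 = 0"
  by (simp add: real_vec_def vec_eq_iff)

lemma real_vec_add: "real_vec (u + v) = real_vec u + real_vec v"
  by (simp add: real_vec_def vec_eq_iff of_rat_add)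

lemma weight_zero [simp]: "weight w 0 = 0"
  by (simp add: weight_def)

lemma weight_add: "weight w (u + v) = weight w u + weight w v"
  by (simp add: weight_def real_vec_add inner_add_right)

text \<open>The coordinates of \<open>u - v\<close> are the coefficients of a rational relation
  between the coordinates of \<open>w\<close>.\<close>

lemma weight_eq_iff:
  assumes "w \<in> lin_indep_vecs"
  shows "weight w u = weight w v \<longleftrightarrow> u = v"
proof
  assume "weight w u = weight w v"
  then have "(\<Sum>i\<in>UNIV. of_rat (u $ i - v $ i) * w $ i) = 0"
    by (simp add: weight_def real_vec_def inner_vec_def of_rat_diff algebra_simps
        sum_subtractf mult.commute)
  then have "\<forall>i. u $ i - v $ i = 0"
    using assms[unfolded lin_indep_vecs_def mem_Collect_eq, rule_format, of "\<lambda>i. u $ i - v $ i"]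
    by blast
  then show "u = v" by (simp add: vec_eq_iff)
qed simp

lemma inj_weight: "w \<in> lin_indep_vecs \<Longrightarrow> inj (weight w)"
  by (simp add: inj_def weight_eq_iff)

lemma weight_scaleR: "weight (c *\<^sub>R w) u = c * weight w u"
  by (simp add: weight_def)

lemma lin_indep_vecs_scaleR:
  assumes "c \<noteq> 0"
  shows "c *\<^sub>R w \<in> lin_indep_vecs \<longleftrightarrow> w \<in> lin_indep_vecs"
proof -
  have "(\<Sum>i\<in>UNIV. of_rat (d i) * (c *\<^sub>R w) $ i) = c * (\<Sum>i\<in>UNIV. of_rat (d i) * w $ i)"
    for d :: "'a \<Rightarrow> rat"
    by (simp add: sum_distrib_left mult_ac)
  then show ?thesis using assms by (simp add: lin_indep_vecs_def)
qed

text \<open>The positive multiples of a ball around \<open>w\<close> form an open cone, and a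
  property stable under positive scaling passes from the ball to it. This replaces the cones in
  conditions (a) and (d) of \<open>p\<close>-discreteness by the neighbourhood filter, where
  conditions are easily combined.\<close>

lemma ex_open_cone_iff_eventually:
  fixes w :: "'a::real_normed_vector"
  assumes scale: "\<And>x c. P x \<Longrightarrow> c > 0 \<Longrightarrow> P (c *\<^sub>R x)"
  shows "(\<exists>\<sigma>. open_cone \<sigma> \<and> w \<in> \<sigma> \<and> (\<forall>x\<in>\<sigma>. P x)) \<longleftrightarrow> eventually P (nhds w)"
proof
  assume "\<exists>\<sigma>. open_cone \<sigma> \<and> w \<in> \<sigma> \<and> (\<forall>x\<in>\<sigma>. P x)"
  then show "eventually P (nhds w)"
    by (auto simp: open_cone_def eventually_nhds)
next
  assume "eventually P (nhds w)"
  then obtain e where e: "e > 0" "\<And>x. x \<in> ball w e \<Longrightarrow> P x"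
    by (auto simp: eventually_nhds_metric dist_commute)
  define \<sigma> where "\<sigma> = (\<Union>c\<in>{0<..}. (*\<^sub>R) c ` ball w e)"
  have I: "c *\<^sub>R x \<in> \<sigma>" if "c > 0" "x \<in> ball w e" for c x
    using that unfolding \<sigma>_def by blast
  have E: "\<exists>c>0. \<exists>y\<in>ball w e. x = c *\<^sub>R y" if "x \<in> \<sigma>" for x
    using that unfolding \<sigma>_def by blast
  have "convex \<sigma>"
  proof (rule convexI)
    fix x y and s t :: real
    assume xy: "x \<in> \<sigma>" "y \<in> \<sigma>" and st: "0 \<le> s" "0 \<le> t" "s + t = 1"
    obtain c x' where x: "c > 0" "x' \<in> ball w e" "x = c *\<^sub>R x'" using E[OF xy(1)] by blast
    obtain d y' where y: "d > 0" "y' \<in> ball w e" "y = d *\<^sub>R y'" using E[OF xy(2)] by blast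
    \<comment> \<open>The combination is \<open>a + b\<close> times a convex combination of
      \<open>x'\<close> and \<open>y'\<close>, which stays in the ball.\<close>
    define a b where "a = s * c" and "b = t * d"
    have ab: "a \<ge> 0" "b \<ge> 0" using st x(1) y(1) by (simp_all add: a_def b_def)
    have "s > 0 \<or> t > 0" using st by linarith
    then have pos: "a + b > 0"
      using ab x(1) y(1) by (auto simp: a_def b_def intro: add_pos_nonneg add_nonneg_pos)
    have "(a / (a + b)) *\<^sub>R x' + (b / (a + b)) *\<^sub>R y' \<in> ball w e"
      using x(2) y(2) ab pos
      by (intro convexD[OF convex_ball]) (auto simp flip: add_divide_distrib)
    from I[OF pos this] show "s *\<^sub>R x + t *\<^sub>R y \<in> \<sigma>"
      using pos by (simp add: scaleR_add_right x(3) y(3) a_def b_def)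
  qed
  moreover have "c *\<^sub>R x \<in> \<sigma>" if "x \<in> \<sigma>" "c > 0" for c x
    using E[OF that(1)] that(2) I by (metis mult_pos_pos scaleR_scaleR)
  moreover have "open \<sigma>"
    unfolding \<sigma>_def by (intro open_UN ballI open_scaling) auto
  moreover have "w \<in> \<sigma>" using I[of 1 w] e(1) by simp
  moreover have "P x" if "x \<in> \<sigma>" for x using E[OF that] e(2) scale by blast
  ultimately show "\<exists>\<sigma>. open_cone \<sigma> \<and> w \<in> \<sigma> \<and> (\<forall>x\<in>\<sigma>. P x)"
    by (auto simp: open_cone_def is_cone_def)
qed

section \<open>Denominators\<close>

definition p_frac :: "nat \<Rightarrow> nat \<Rightarrow> rat set" where
  "p_frac N p = (\<Union>j. {q. \<exists>m::int. q = of_int m / of_nat (N * p ^ j)})"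

lemma p_frac_raise:
  assumes "p > 0" and "M > 0"
  shows "(of_int m :: rat) / of_nat (N * p ^ j)
    = of_int (m * int (M * p ^ k)) / of_nat (N * M * p ^ (j + k))"
  using assms by (simp add: power_add divide_simps)

lemma p_frac_add:
  assumes "p > 0" "N > 0" "M > 0" and "x \<in> p_frac N p" and "y \<in> p_frac M p"
  shows "x + y \<in> p_frac (N * M) p"
proof -
  obtain m j where x: "x = of_int m / of_nat (N * p ^ j)"
    using assms(4) unfolding p_frac_def by blast
  obtain l k where y: "y = of_int l / of_nat (M * p ^ k)"
    using assms(5) unfolding p_frac_def by blast
  have "x + y = of_int (m * int (M * p ^ k) + l * int (N * p ^ j)) / of_nat (N * M * p ^ (j + k))"
    unfolding x y p_frac_raise[OF assms(1,3), of m N j k] p_frac_raise[OF assms(1,2), of l M k j]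
    by (simp add: add_divide_distrib mult_ac add.commute)
  then show ?thesis unfolding p_frac_def by blast
qed

lemma p_frac_mono:
  assumes "p > 0" "M > 0" and "x \<in> p_frac N p"
  shows "x \<in> p_frac (N * M) p" "x \<in> p_frac (M * N) p"
proof -
  obtain m j where "x = of_int m / of_nat (N * p ^ j)"
    using assms(3) unfolding p_frac_def by blast
  then have "x = of_int (m * int (M * p ^ 0)) / of_nat (N * M * p ^ (j + 0))"
    using p_frac_raise[OF assms(1,2)] by metis
  then show "x \<in> p_frac (N * M) p" unfolding p_frac_def by blast
  then show "x \<in> p_frac (M * N) p" by (simp add: mult.commute)
qed

lemma p_frac_of_int_mult:
  assumes "x \<in> p_frac N p"
  shows "of_int k * x \<in> p_frac N p"
proof -
  obtain m j where "x = of_int m / of_nat (N * p ^ j)"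
    using assms unfolding p_frac_def by blast
  then have "of_int k * x = of_int (k * m) / of_nat (N * p ^ j)" by simp
  then show ?thesis unfolding p_frac_def by blast
qed

lemma zero_in_p_frac: "0 \<in> p_frac N p"
  unfolding p_frac_def by (intro UN_I[of 0] CollectI exI[of _ 0]) simp_all

text \<open>\<open>frac_lattice\<close> demands one exponent of \<open>p\<close> for all
  coordinates; the sum of the exponents of the single coordinates serves as such.\<close>

lemma frac_lattice_iff:
  assumes "p > 0"
  shows "u \<in> frac_lattice N p \<longleftrightarrow> (\<forall>i. u $ i \<in> p_frac N p)"
proof
  assume "u \<in> frac_lattice N p"
  then show "\<forall>i. u $ i \<in> p_frac N p" unfolding frac_lattice_def p_frac_def by blast
next
  assume "\<forall>i. u $ i \<in> p_frac N p"
  then have "\<forall>i. \<exists>j m. u $ i = of_int m / of_nat (N * p ^ j)" unfolding p_frac_def by blast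
  then obtain j m where u: "\<And>i. u $ i = of_int (m i) / of_nat (N * p ^ j i)" by metis
  have "\<exists>l. u $ i = of_int l / of_nat (N * p ^ (\<Sum>i\<in>UNIV. j i))" for i
  proof -
    have "j i \<le> (\<Sum>i\<in>UNIV. j i)" by (rule member_le_sum) auto
    then obtain k where "(\<Sum>i\<in>UNIV. j i) = j i + k" using le_Suc_ex by blast
    then show ?thesis
      using p_frac_raise[OF assms, of 1 "m i" N "j i" k] u[of i] by (metis mult.right_neutral zero_less_one)
  qed
  then show "u \<in> frac_lattice N p" unfolding frac_lattice_def by blast
qed

section \<open>The conditions for p-discreteness in terms of neighbourhoods\<close>

definition wo_near :: "real ^ 'd \<Rightarrow> (rat ^ 'd) set \<Rightarrow> bool" where
  "wo_near w A \<longleftrightarrow> (\<forall>\<^sub>F w' in nhds w. w' \<in> lin_indep_vecs \<longrightarrow> wo_under (weight w') A)"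

text \<open>The cone part of condition (b) in quantitative form: the cone becomes the inequality
  with slope \<open>\<epsilon>\<close>, and its translation is absorbed into
  \<open>M\<close>.\<close>

definition cone_bounded :: "real ^ 'd \<Rightarrow> (rat ^ 'd) set \<Rightarrow> bool" where
  "cone_bounded w A \<longleftrightarrow> (\<exists>\<epsilon>>0. \<exists>M. \<forall>a\<in>A. \<epsilon> * norm (real_vec a) \<le> weight w a + M)"

definition rational_limits :: "real ^ 'd \<Rightarrow> (rat ^ 'd) set \<Rightarrow> bool" where
  "rational_limits w A \<longleftrightarrow>
    (\<forall>a :: nat \<Rightarrow> rat ^ 'd. (\<forall>i. a i \<in> A) \<longrightarrow> convergent (\<lambda>i. weight w (a i)) \<longrightarrow>
      (\<exists>q. (\<lambda>i. real_vec (a i)) \<longlonglongrightarrow> real_vec q))"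

text \<open>Condition (d) as implications between strict inequalities; the case of equal weights is
  left to linear independence.\<close>

definition stable_sides :: "real ^ 'd \<Rightarrow> (rat ^ 'd) set \<Rightarrow> bool" where
  "stable_sides w A \<longleftrightarrow>
    (\<forall>\<gamma>. \<forall>\<^sub>F w' in nhds w. w' \<in> lin_indep_vecs \<longrightarrow> (\<forall>a\<in>A.
      (weight w a < weight w \<gamma> \<longrightarrow> weight w' a < weight w' \<gamma>) \<and>
      (weight w a > weight w \<gamma> \<longrightarrow> weight w' a > weight w' \<gamma>)))"

text \<open>A ball around \<open>w\<close> inside the dual cone bounds \<open>norm y\<close> by a
  multiple of \<open>w \<bullet> y\<close> on the cone. Conversely, the vectors satisfying such a
  bound form a closed pointed cone with \<open>w\<close> in the interior of its dual, and a rational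
  translation far enough against \<open>w\<close> moves \<open>A\<close> into it.\<close>

lemma cone_bounded_iff:
  fixes w :: "real ^ 'd"
  assumes w: "w \<in> lin_indep_vecs"
  shows "cone_bounded w A \<longleftrightarrow>
    (\<exists>\<gamma> C. pointed_cone C \<and> w \<in> interior (dual_cone C) \<and>
      real_vec ` A \<subseteq> (\<lambda>y. real_vec \<gamma> + y) ` C)"
proof
  assume "\<exists>\<gamma> C. pointed_cone C \<and> w \<in> interior (dual_cone C) \<and>
    real_vec ` A \<subseteq> (\<lambda>y. real_vec \<gamma> + y) ` C"
  then obtain \<gamma> C where int: "w \<in> interior (dual_cone C)"
    and AC: "real_vec ` A \<subseteq> (\<lambda>y. real_vec \<gamma> + y) ` C" by blast
  obtain e where e: "e > 0" "cball w e \<subseteq> dual_cone C"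
    using int mem_interior_cball by blast
  have C: "e * norm y \<le> w \<bullet> y" if "y \<in> C" for y
  proof (cases "y = 0")
    case False
    \<comment> \<open>This is the point of the ball whose inner product with \<open>y\<close> is
      smallest.\<close>
    have "w - (e / norm y) *\<^sub>R y \<in> cball w e" using e(1) False by (simp add: dist_norm)
    then have "w - (e / norm y) *\<^sub>R y \<in> dual_cone C" using e(2) by blast
    then have "0 \<le> (w - (e / norm y) *\<^sub>R y) \<bullet> y"
      using that unfolding dual_cone_def by blast
    then show ?thesis
      using False by (simp add: inner_diff_left dot_square_norm power2_eq_square)
  qed simp
  show "cone_bounded w A" unfolding cone_bounded_def
  proof (intro exI conjI ballI)
    fix a assume "a \<in> A"
    then obtain y where y: "y \<in> C" "real_vec a = real_vec \<gamma> + y" using AC by blast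
    have "norm (real_vec a) \<le> norm (real_vec \<gamma>) + norm y"
      unfolding y(2) by (rule norm_triangle_ineq)
    then have "e * norm (real_vec a) \<le> e * norm (real_vec \<gamma>) + e * norm y"
      using e(1) by (metis distrib_left less_imp_le mult_left_mono)
    also have "\<dots> \<le> e * norm (real_vec \<gamma>) + w \<bullet> y" using C[OF y(1)] by simp
    also have "w \<bullet> y = weight w a - weight w \<gamma>"
      by (simp add: weight_def y(2) inner_add_right)
    finally show "e * norm (real_vec a) \<le> weight w a + (e * norm (real_vec \<gamma>) - weight w \<gamma>)"
      by simp
  qed (rule e(1))
next
  assume "cone_bounded w A"
  then obtain e M where e: "e > 0" and A: "\<And>a. a \<in> A \<Longrightarrow> e * norm (real_vec a) \<le> weight w a + M"
    unfolding cone_bounded_def by blast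
  \<comment> \<open>A rational unit vector of positive weight: a coordinate direction, with sign
    taken from \<open>w\<close>. The index \<open>undefined\<close> is just some coordinate, and
    linear independence excludes weight 0.\<close>
  define v :: "rat ^ 'd" where "v = axis undefined (if w $ undefined > 0 then 1 else -1)"
  have v_ne: "v \<noteq> 0" by (simp add: v_def vec_eq_iff axis_def)
  have v_vec: "real_vec v = axis undefined (if w $ undefined > 0 then 1 else -1)"
    by (auto simp: v_def real_vec_def axis_def vec_eq_iff)
  have "weight w v \<ge> 0"
    unfolding weight_def v_vec by (auto simp: inner_axis)
  moreover have "weight w v \<noteq> 0" using weight_eq_iff[OF w, of v 0] v_ne by simp
  ultimately have v_pos: "weight w v > 0" by simp
  have v_norm: "norm (real_vec v) = 1" by (simp add: v_vec norm_eq_sqrt_inner inner_axis_axis)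
  \<comment> \<open>The slope is at most \<open>e\<close> to fit the bound on \<open>A\<close>, and
    at most half of \<open>weight w v\<close> so that translating by \<open>K\<close> copies of
    \<open>v\<close> gains more than it costs. The number \<open>K\<close> is chosen so that the net
    gain exceeds \<open>M\<close>.\<close>
  define d where "d = min e (weight w v / 2)"
  have d: "d > 0" "d \<le> e" "d \<le> weight w v / 2" using e v_pos by (auto simp: d_def)
  obtain K :: nat where K: "2 * M / weight w v < real K" using reals_Archimedean2 by blast
  then have KM: "2 * M < real K * weight w v" using v_pos by (simp add: divide_simps)
  define \<gamma> where "\<gamma> = of_int (- int K) *s v"
  have \<gamma>: "real_vec \<gamma> = - (real K *\<^sub>R real_vec v)"
    by (simp add: \<gamma>_def real_vec_def vec_eq_iff of_rat_mult of_rat_minus)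
  define C where "C = {y. d * norm y \<le> w \<bullet> y}"
  have "is_cone C" unfolding is_cone_def
  proof (intro conjI ballI allI impI convexI)
    fix x y and s t :: real
    assume xy: "x \<in> C" "y \<in> C" and st: "0 \<le> s" "0 \<le> t"
    have "d * norm (s *\<^sub>R x + t *\<^sub>R y) \<le> d * (s * norm x + t * norm y)"
      using norm_triangle_ineq[of "s *\<^sub>R x" "t *\<^sub>R y"] st d(1) by simp
    also have "\<dots> = s * (d * norm x) + t * (d * norm y)" by (simp add: algebra_simps)
    also have "\<dots> \<le> s * (w \<bullet> x) + t * (w \<bullet> y)"
      using xy st by (intro add_mono mult_left_mono) (auto simp: C_def)
    finally show "s *\<^sub>R x + t *\<^sub>R y \<in> C" by (simp add: C_def inner_add_right)
  qed (auto simp: C_def mult.left_commute)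
  moreover have "closed C"
    unfolding C_def by (intro closed_Collect_le continuous_intros)
  moreover have False if "v' \<noteq> 0" "\<And>t. x + t *\<^sub>R v' \<in> C" for x v'
  proof -
    \<comment> \<open>In the sum of the cone inequalities at \<open>t\<close> and \<open>- t\<close>
      the terms \<open>w \<bullet> v'\<close> cancel, which leaves a bound independent of
      \<open>t\<close>.\<close>
    have *: "t * (d * norm v') \<le> d * norm x + w \<bullet> x" if "t > 0" for t
    proof -
      have "norm (t *\<^sub>R v') + norm (t *\<^sub>R v') \<le> norm (x + t *\<^sub>R v') + norm (x + (- t) *\<^sub>R v') + 2 * norm x"
        using norm_triangle_ineq4[of "x + t *\<^sub>R v'" x] norm_triangle_ineq4[of x "x + (- t) *\<^sub>R v'"]
        by simp
      then have "d * (norm (t *\<^sub>R v') + norm (t *\<^sub>R v'))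
          \<le> d * (norm (x + t *\<^sub>R v') + norm (x + (- t) *\<^sub>R v') + 2 * norm x)"
        using d(1) by simp
      moreover have "d * norm (x + t *\<^sub>R v') + d * norm (x + (- t) *\<^sub>R v')
          \<le> w \<bullet> (x + t *\<^sub>R v') + w \<bullet> (x + (- t) *\<^sub>R v')"
        using \<open>x + t *\<^sub>R v' \<in> C\<close> \<open>x + (- t) *\<^sub>R v' \<in> C\<close> unfolding C_def by force
      ultimately show ?thesis using that by (simp add: algebra_simps)
    qed
    have pos: "d * norm v' > 0" using d(1) that(1) by simp
    define t where "t = (\<bar>d * norm x + w \<bullet> x\<bar> + 1) / (d * norm v')"
    have "t > 0" unfolding t_def using pos by (simp add: add_nonneg_pos)
    moreover have "t * (d * norm v') = \<bar>d * norm x + w \<bullet> x\<bar> + 1"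
      unfolding t_def using d(1) that(1) by simp
    ultimately show False using *[of t] by linarith
  qed
  ultimately have "pointed_cone C" unfolding pointed_cone_def by (metis closure_closed)
  moreover have "w \<in> interior (dual_cone C)"
  proof -
    have "cball w d \<subseteq> dual_cone C"
    proof
      fix w' assume w': "w' \<in> cball w d"
      have "0 \<le> w' \<bullet> y" if "y \<in> C" for y
      proof -
        have "(w - w') \<bullet> y \<le> norm (w - w') * norm y" by (rule norm_cauchy_schwarz)
        also have "\<dots> \<le> d * norm y"
          using w' by (intro mult_right_mono) (auto simp: dist_norm)
        also have "\<dots> \<le> w \<bullet> y" using that by (simp add: C_def)
        finally show ?thesis by (simp add: inner_diff_left)
      qed
      then show "w' \<in> dual_cone C" by (simp add: dual_cone_def)
    qed
    then show ?thesis using d(1) mem_interior_cball by blast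
  qed
  moreover have "real_vec ` A \<subseteq> (\<lambda>y. real_vec \<gamma> + y) ` C"
  proof
    fix x assume "x \<in> real_vec ` A"
    then obtain a where a: "a \<in> A" "x = real_vec a" by blast
    have "norm (real_vec a - real_vec \<gamma>) \<le> norm (real_vec a) + real K"
      unfolding \<gamma> using norm_triangle_ineq[of "real_vec a" "real K *\<^sub>R real_vec v"] v_norm by simp
    then have "d * norm (real_vec a - real_vec \<gamma>) \<le> d * norm (real_vec a) + d * real K"
      using d(1) by (metis distrib_left less_imp_le mult_left_mono)
    also have "\<dots> \<le> e * norm (real_vec a) + weight w v / 2 * real K"
      using d by (intro add_mono mult_right_mono) auto
    also have "\<dots> \<le> weight w a + real K * weight w v"
      using A[OF a(1)] KM by (simp add: mult.commute)
    also have "\<dots> = w \<bullet> (real_vec a - real_vec \<gamma>)"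
      by (simp add: weight_def \<gamma> inner_add_right)
    finally have "x - real_vec \<gamma> \<in> C" by (simp add: C_def a(2))
    then show "x \<in> (\<lambda>y. real_vec \<gamma> + y) ` C" by (intro image_eqI[of _ _ "x - real_vec \<gamma>"]) auto
  qed
  ultimately show "\<exists>\<gamma> C. pointed_cone C \<and> w \<in> interior (dual_cone C) \<and>
      real_vec ` A \<subseteq> (\<lambda>y. real_vec \<gamma> + y) ` C" by blast
qed

lemma wo_near_iff:
  "wo_near w A \<longleftrightarrow> (\<exists>\<sigma>. open_cone \<sigma> \<and> w \<in> \<sigma> \<and>
      (\<forall>w' \<in> \<sigma> \<inter> lin_indep_vecs. well_ordered_by (\<le>) (weight w' ` A)))"
proof -
  have "wo_under (weight (c *\<^sub>R x)) A" if "wo_under (weight x) A" "c > 0" for c x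
    using that unfolding wo_under_def weight_scaleR incseq_def by (simp add: mult_left_mono)
  then show ?thesis
    unfolding wo_near_def well_ordered_by_image
    by (subst ex_open_cone_iff_eventually[symmetric]) (auto simp: lin_indep_vecs_scaleR)
qed

text \<open>If \<open>a\<close> and \<open>\<gamma>\<close> have equal weight for \<open>w\<close>,
  then \<open>a = \<gamma>\<close> and the weights agree for \<open>w'\<close> too. Hence the two
  one-way implications already determine both sides.\<close>

lemma above_below_eq_iff:
  assumes w: "w \<in> lin_indep_vecs" and w': "w' \<in> lin_indep_vecs"
  shows "above A \<gamma> w' = above A \<gamma> w \<and> below A \<gamma> w' = below A \<gamma> w \<longleftrightarrow>
    (\<forall>a\<in>A. (weight w a < weight w \<gamma> \<longrightarrow> weight w' a < weight w' \<gamma>) \<and>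
      (weight w a > weight w \<gamma> \<longrightarrow> weight w' a > weight w' \<gamma>))" (is "?l \<longleftrightarrow> ?r")
proof
  assume ?r
  then have "weight w' a < weight w' \<gamma> \<longleftrightarrow> weight w a < weight w \<gamma>"
    "weight w' a > weight w' \<gamma> \<longleftrightarrow> weight w a > weight w \<gamma>" if "a \<in> A" for a
    using that weight_eq_iff[OF w, of a \<gamma>] by (metis less_asym linorder_less_linear)+
  then show ?l unfolding above_def below_def by blast
qed (auto simp: above_def below_def set_eq_iff)

lemma stable_sides_iff:
  assumes w: "w \<in> lin_indep_vecs"
  shows "stable_sides w A \<longleftrightarrow> (\<forall>\<gamma>'. \<exists>\<sigma>. open_cone \<sigma> \<and> w \<in> \<sigma> \<and>
      (\<forall>w' \<in> \<sigma> \<inter> lin_indep_vecs.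
        above A \<gamma>' w' = above A \<gamma>' w \<and> below A \<gamma>' w' = below A \<gamma>' w))"
  unfolding stable_sides_def
proof (subst ex_open_cone_iff_eventually[symmetric])
  show "(\<forall>\<gamma>. \<exists>\<sigma>. open_cone \<sigma> \<and> w \<in> \<sigma> \<and> (\<forall>w'\<in>\<sigma>. w' \<in> lin_indep_vecs \<longrightarrow> (\<forall>a\<in>A.
      (weight w a < weight w \<gamma> \<longrightarrow> weight w' a < weight w' \<gamma>) \<and>
      (weight w a > weight w \<gamma> \<longrightarrow> weight w' a > weight w' \<gamma>)))) \<longleftrightarrow>
    (\<forall>\<gamma>'. \<exists>\<sigma>. open_cone \<sigma> \<and> w \<in> \<sigma> \<and> (\<forall>w' \<in> \<sigma> \<inter> lin_indep_vecs.
        above A \<gamma>' w' = above A \<gamma>' w \<and> below A \<gamma>' w' = below A \<gamma>' w))"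
    unfolding Int_iff Ball_def[of "_ \<inter> _"] imp_conjL using above_below_eq_iff[OF w] by meson
qed (auto simp: lin_indep_vecs_scaleR weight_scaleR)

text \<open>In condition (b) the denominator and the cone are chosen independently, so it splits
  into two conditions.\<close>

lemma p_discrete_iff:
  assumes "w \<in> lin_indep_vecs"
  shows "p_discrete p w A \<longleftrightarrow> wo_near w A \<and> cone_bounded w A \<and>
    (\<exists>N>0. A \<subseteq> frac_lattice N p) \<and> rational_limits w A \<and> stable_sides w A"
  unfolding p_discrete_def wo_near_iff cone_bounded_iff[OF assms] rational_limits_def
    stable_sides_iff[OF assms]
  by blast


subsection \<open>Sums of p-discrete sets\<close>

lemma wo_near_subset: "wo_near w A \<Longrightarrow> B \<subseteq> A \<Longrightarrow> wo_near w B"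
  unfolding wo_near_def by (auto elim!: eventually_mono intro: wo_under_subset)

lemma wo_near_Un: "wo_near w A \<Longrightarrow> wo_near w B \<Longrightarrow> wo_near w (A \<union> B)"
  unfolding wo_near_def by (erule (1) eventually_elim2) (blast intro: wo_under_Un)

lemma wo_near_sumset:
  "wo_near w A \<Longrightarrow> wo_near w B \<Longrightarrow> wo_near w ((\<lambda>(a, b). a + b) ` (A \<times> B))"
  unfolding wo_near_def by (erule (1) eventually_elim2) (blast intro: wo_under_sumset weight_add)

lemma wo_near_imp_wo_under: "wo_near w A \<Longrightarrow> w \<in> lin_indep_vecs \<Longrightarrow> wo_under (weight w) A"
  unfolding wo_near_def by (blast dest: eventually_nhds_x_imp_x)

lemma cone_bounded_subset: "cone_bounded w A \<Longrightarrow> B \<subseteq> A \<Longrightarrow> cone_bounded w B"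
  unfolding cone_bounded_def by blast

lemma cone_bounded_commonE:
  assumes "cone_bounded w A" and "cone_bounded w B"
  obtains e M where "e > 0" and "M \<ge> 0"
    and "\<And>a. a \<in> A \<Longrightarrow> e * norm (real_vec a) \<le> weight w a + M"
    and "\<And>b. b \<in> B \<Longrightarrow> e * norm (real_vec b) \<le> weight w b + M"
proof -
  obtain e M where A: "e > 0" "\<And>a. a \<in> A \<Longrightarrow> e * norm (real_vec a) \<le> weight w a + M"
    using assms(1) unfolding cone_bounded_def by blast
  obtain e' M' where B: "e' > 0" "\<And>b. b \<in> B \<Longrightarrow> e' * norm (real_vec b) \<le> weight w b + M'"
    using assms(2) unfolding cone_bounded_def by blast
  have le: "min e e' * norm x \<le> e * norm x" "min e e' * norm x \<le> e' * norm x" for x :: "real ^ 'a"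
    by (simp_all add: mult_right_mono)
  show thesis
  proof (rule that[of "min e e'" "\<bar>M\<bar> + \<bar>M'\<bar>"])
    show "min e e' * norm (real_vec a) \<le> weight w a + (\<bar>M\<bar> + \<bar>M'\<bar>)" if "a \<in> A" for a
      using A(2)[OF that] le(1)[of "real_vec a"] by linarith
    show "min e e' * norm (real_vec b) \<le> weight w b + (\<bar>M\<bar> + \<bar>M'\<bar>)" if "b \<in> B" for b
      using B(2)[OF that] le(2)[of "real_vec b"] by linarith
  qed (use A(1) B(1) in auto)
qed

lemma cone_bounded_Un: "cone_bounded w A \<Longrightarrow> cone_bounded w B \<Longrightarrow> cone_bounded w (A \<union> B)"
  by (erule (1) cone_bounded_commonE, unfold cone_bounded_def) blast

lemma cone_bounded_sumset:
  assumes "cone_bounded w A" and "cone_bounded w B"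
  shows "cone_bounded w ((\<lambda>(a, b). a + b) ` (A \<times> B))"
proof -
  obtain e M where e: "e > 0" and A: "\<And>a. a \<in> A \<Longrightarrow> e * norm (real_vec a) \<le> weight w a + M"
    and B: "\<And>b. b \<in> B \<Longrightarrow> e * norm (real_vec b) \<le> weight w b + M"
    using cone_bounded_commonE[OF assms] by metis
  have "e * norm (real_vec (a + b)) \<le> weight w (a + b) + (M + M)" if "a \<in> A" "b \<in> B" for a b
  proof -
    have "e * norm (real_vec (a + b)) \<le> e * (norm (real_vec a) + norm (real_vec b))"
      unfolding real_vec_add using e by (intro mult_left_mono norm_triangle_ineq) simp
    then show ?thesis using A[OF that(1)] B[OF that(2)] by (simp add: weight_add distrib_left)
  qed
  then show ?thesis unfolding cone_bounded_def using e by (intro exI[of _ e] exI[of _ "M + M"]) auto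
qed

lemma frac_lattice_mono:
  assumes "p > 0" "M > 0" "A \<subseteq> frac_lattice N p"
  shows "A \<subseteq> frac_lattice (N * M) p" "A \<subseteq> frac_lattice (M * N) p"
  using assms p_frac_mono[OF assms(1,2)] by (auto simp: frac_lattice_iff subset_iff)

lemma frac_lattice_sumset:
  assumes "p > 0" "N > 0" "M > 0" "A \<subseteq> frac_lattice N p" "B \<subseteq> frac_lattice M p"
  shows "(\<lambda>(a, b). a + b) ` (A \<times> B) \<subseteq> frac_lattice (N * M) p"
  using assms p_frac_add[OF assms(1-3)] by (auto simp: frac_lattice_iff subset_iff)

section \<open>Limits in unions and sumsets\<close>

lemma tendsto_weight:
  assumes "(f \<longlongrightarrow> w) F" and "((\<lambda>i. real_vec (c i)) \<longlongrightarrow> real_vec z) F"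
  shows "((\<lambda>i. weight (f i) (c i)) \<longlongrightarrow> weight w z) F"
  unfolding weight_def using assms by (intro tendsto_inner)

lemma rational_limitsD:
  assumes "rational_limits w A" and "\<And>i::nat. a i \<in> A" and "convergent (\<lambda>i. weight w (a i))"
  obtains q where "(\<lambda>i. real_vec (a i)) \<longlonglongrightarrow> real_vec q"
  using assms unfolding rational_limits_def by blast

text \<open>Passing to subsequences is harmless because the weight of the limit determines it.\<close>

lemma rational_limitsI:
  assumes w: "w \<in> lin_indep_vecs"
    and subseq: "\<And>a. (\<And>i::nat. a i \<in> A) \<Longrightarrow> convergent (\<lambda>i. weight w (a i)) \<Longrightarrow>
      \<exists>r q. strict_mono (r :: nat \<Rightarrow> nat) \<and> (\<lambda>i. real_vec (a (r i))) \<longlonglongrightarrow> real_vec q"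
  shows "rational_limits w A"
  unfolding rational_limits_def
proof (intro allI impI)
  fix a :: "nat \<Rightarrow> _" assume a: "\<forall>i. a i \<in> A" and conv: "convergent (\<lambda>i. weight w (a i))"
  have weight_limit: "weight w q = lim (\<lambda>i. weight w (a i))"
    if r: "strict_mono r" and q: "(\<lambda>i. real_vec (a (r i))) \<longlonglongrightarrow> real_vec q" for r q
  proof -
    have "(\<lambda>i. weight w (a (r i))) \<longlonglongrightarrow> lim (\<lambda>i. weight w (a i))"
      using LIMSEQ_subseq_LIMSEQ[OF conv[unfolded convergent_LIMSEQ_iff] r] by (simp add: o_def)
    moreover have "(\<lambda>i. weight w (a (r i))) \<longlonglongrightarrow> weight w q"
      by (rule tendsto_weight[OF tendsto_const q])
    ultimately show ?thesis using LIMSEQ_unique by blast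
  qed
  obtain r q where r: "strict_mono r" and q: "(\<lambda>i. real_vec (a (r i))) \<longlonglongrightarrow> real_vec q"
    using subseq[of a] a conv by blast
  have "(\<lambda>i. real_vec (a i)) \<longlonglongrightarrow> real_vec q"
  proof (rule ccontr)
    \<comment> \<open>Some subsequence would stay away from \<open>q\<close>. It has itself a
      convergent subsequence, whose limit \<open>q'\<close> has the same weight as \<open>q\<close>
      and therefore equals it.\<close>
    assume "\<not> (\<lambda>i. real_vec (a i)) \<longlonglongrightarrow> real_vec q"
    then obtain e where e: "e > 0" "\<not> (\<forall>\<^sub>F i in sequentially. dist (real_vec (a i)) (real_vec q) < e)"
      unfolding tendsto_iff by blast
    obtain s :: "nat \<Rightarrow> nat" where s: "strict_mono s" "\<And>i. \<not> dist (real_vec (a (s i))) (real_vec q) < e"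
      using not_eventually_sequentiallyD[OF e(2)] by blast
    have "convergent (\<lambda>i. weight w (a (s i)))"
      using convergent_subseq_convergent[OF conv s(1)] by (simp add: o_def)
    then obtain t q' where t: "strict_mono t" "(\<lambda>i. real_vec (a (s (t i)))) \<longlonglongrightarrow> real_vec q'"
      using subseq[of "\<lambda>i. a (s i)"] a by blast
    have "weight w q' = weight w q"
      using weight_limit[OF r q] weight_limit[of "\<lambda>i. s (t i)" q'] t strict_mono_o[OF s(1) t(1)]
      by (simp add: o_def)
    then have "q' = q" by (simp add: weight_eq_iff[OF w])
    with t(2) e(1) have "\<forall>\<^sub>F i in sequentially. dist (real_vec (a (s (t i)))) (real_vec q) < e"
      by (simp add: tendsto_iff)
    with s(2) show False by simp
  qed
  then show "\<exists>q. (\<lambda>i. real_vec (a i)) \<longlonglongrightarrow> real_vec q" ..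
qed

lemma rational_limits_subset: "rational_limits w A \<Longrightarrow> B \<subseteq> A \<Longrightarrow> rational_limits w B"
  unfolding rational_limits_def by blast

lemma rational_limits_Un:
  fixes A B :: "(rat ^ 'd) set"
  assumes w: "w \<in> lin_indep_vecs" and A: "rational_limits w A" and B: "rational_limits w B"
  shows "rational_limits w (A \<union> B)"
proof (rule rational_limitsI[OF w])
  fix a :: "nat \<Rightarrow> rat ^ 'd"
  assume a: "\<And>i. a i \<in> A \<union> B" and conv: "convergent (\<lambda>i. weight w (a i))"
  from a have "a i \<in> A \<or> a i \<in> B" for i by blast
  then obtain r :: "nat \<Rightarrow> nat" and D where r: "strict_mono r"
    and D: "rational_limits w D" "\<And>i. a (r i) \<in> D"
    by (rule subseq_disjE[of "\<lambda>i. a i \<in> A" "\<lambda>i. a i \<in> B"]) (use A B in blast)+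
  have "convergent (\<lambda>i. weight w (a (r i)))"
    using convergent_subseq_convergent[OF conv r] by (simp add: o_def)
  then obtain q where "(\<lambda>i. real_vec (a (r i))) \<longlonglongrightarrow> real_vec q"
    by (rule rational_limitsD[OF D])
  with r show "\<exists>r q. strict_mono (r :: nat \<Rightarrow> nat) \<and> (\<lambda>i. real_vec (a (r i))) \<longlonglongrightarrow> real_vec q"
    by blast
qed

text \<open>Bounded increasing weights converge, so the points converge by condition (c), and
  increasing weights stay below their limit.\<close>

lemma rational_limits_incseqE:
  assumes A: "rational_limits w A" and a: "\<And>i::nat. a i \<in> A"
    and inc: "incseq (\<lambda>i. weight w (a i))" and bound: "\<And>i. weight w (a i) \<le> T"
  obtains q where "(\<lambda>i. real_vec (a i)) \<longlonglongrightarrow> real_vec q" and "\<And>i. weight w (a i) \<le> weight w q"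
proof -
  obtain L where "(\<lambda>i. weight w (a i)) \<longlonglongrightarrow> L"
    using incseq_convergent[OF inc, of T] bound by blast
  then obtain q where q: "(\<lambda>i. real_vec (a i)) \<longlonglongrightarrow> real_vec q"
    using rational_limitsD[of w A a, OF A a] by (auto simp: convergent_def)
  have "weight w (a i) \<le> weight w q" for i
    using incseq_le[OF inc tendsto_weight[OF tendsto_const q]] .
  with q that show thesis by blast
qed

text \<open>Once both weights increase, each is bounded by \<open>T\<close> minus the first weight
  of the other summand, so both sequences of summands converge.\<close>

lemma sumset_subseqE:
  assumes A: "wo_under (weight w) A" "rational_limits w A"
    and B: "wo_under (weight w) B" "rational_limits w B"
    and a: "\<And>i::nat. a i \<in> A" and b: "\<And>i. b i \<in> B"
    and bound: "\<And>i. weight w (a i + b i) \<le> T"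
  obtains r q q' where "strict_mono r"
    and "(\<lambda>i. real_vec (a (r i))) \<longlonglongrightarrow> real_vec q" and "\<And>i. weight w (a (r i)) \<le> weight w q"
    and "(\<lambda>i. real_vec (b (r i))) \<longlonglongrightarrow> real_vec q'" and "\<And>i. weight w (b (r i)) \<le> weight w q'"
    and "(\<lambda>i. real_vec (a (r i) + b (r i))) \<longlonglongrightarrow> real_vec (q + q')"
proof -
  obtain r where r: "strict_mono r" and inc: "incseq (\<lambda>i. weight w (a (r i)))"
      "incseq (\<lambda>i. weight w (b (r i)))"
    using wo_under_pairE[OF A(1) B(1) a b] .
  have "weight w (a (r i)) \<le> T - weight w (b (r 0))" for i
    using incseqD[OF inc(2), of 0 i] bound[of "r i"] by (simp add: weight_add)
  then obtain q where q: "(\<lambda>i. real_vec (a (r i))) \<longlonglongrightarrow> real_vec q"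
      "\<And>i. weight w (a (r i)) \<le> weight w q"
    using rational_limits_incseqE[OF A(2) a inc(1)] by blast
  have "weight w (b (r i)) \<le> T - weight w (a (r 0))" for i
    using incseqD[OF inc(1), of 0 i] bound[of "r i"] by (simp add: weight_add)
  then obtain q' where q': "(\<lambda>i. real_vec (b (r i))) \<longlonglongrightarrow> real_vec q'"
      "\<And>i. weight w (b (r i)) \<le> weight w q'"
    using rational_limits_incseqE[OF B(2) b inc(2)] by blast
  have "(\<lambda>i. real_vec (a (r i) + b (r i))) \<longlonglongrightarrow> real_vec (q + q')"
    unfolding real_vec_add by (rule tendsto_add[OF q(1) q'(1)])
  with that[OF r q q'] show thesis .
qed

lemma sumset_seqE:
  assumes "\<And>i. c i \<in> (\<lambda>(a, b). a + b) ` (A \<times> B)"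
  obtains a b where "\<And>i. a i \<in> A" and "\<And>i. b i \<in> B" and "c = (\<lambda>i. a i + b i)"
proof -
  have "\<forall>i. \<exists>a b. a \<in> A \<and> b \<in> B \<and> c i = a + b" using assms by fast
  then obtain a b where "\<And>i. a i \<in> A \<and> b i \<in> B \<and> c i = a i + b i" by metis
  then show thesis using that[of a b] by blast
qed

lemma rational_limits_sumset:
  fixes A B :: "(rat ^ 'd) set"
  assumes w: "w \<in> lin_indep_vecs"
    and A: "wo_under (weight w) A" "rational_limits w A"
    and B: "wo_under (weight w) B" "rational_limits w B"
  shows "rational_limits w ((\<lambda>(a, b). a + b) ` (A \<times> B))"
proof (rule rational_limitsI[OF w])
  fix c :: "nat \<Rightarrow> rat ^ 'd"
  assume c: "\<And>i. c i \<in> (\<lambda>(a, b). a + b) ` (A \<times> B)" and conv: "convergent (\<lambda>i. weight w (c i))"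
  obtain a b where ab: "\<And>i. a i \<in> A" "\<And>i. b i \<in> B" and c_eq: "c = (\<lambda>i. a i + b i)"
    using sumset_seqE[of c, OF c] by blast
  obtain T where "\<And>i. norm (weight w (c i)) \<le> T"
    using convergent_imp_Bseq[OF conv] unfolding Bseq_def by blast
  then have "weight w (a i + b i) \<le> T" for i
    unfolding c_eq by (metis abs_le_D1 real_norm_def)
  then obtain r q where "strict_mono r" "(\<lambda>i. real_vec (a (r i) + b (r i))) \<longlonglongrightarrow> real_vec q"
    by (rule sumset_subseqE[of w A B a b T, OF A B ab]) (rule that)
  then show "\<exists>r q. strict_mono (r :: nat \<Rightarrow> nat) \<and> (\<lambda>i. real_vec (c (r i))) \<longlonglongrightarrow> real_vec q"
    unfolding c_eq by blast
qed

section \<open>Stability of the two sides of a point\<close>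

lemma stable_sides_subset: "stable_sides w A \<Longrightarrow> B \<subseteq> A \<Longrightarrow> stable_sides w B"
  unfolding stable_sides_def by (fast elim: eventually_mono)

lemma stable_sides_Un: "stable_sides w A \<Longrightarrow> stable_sides w B \<Longrightarrow> stable_sides w (A \<union> B)"
  unfolding stable_sides_def ball_Un by (fast elim: eventually_elim2)

lemma not_eventually_nhdsE:
  fixes w :: "'a::metric_space"
  assumes "\<not> eventually P (nhds w)"
  obtains f where "f \<longlonglongrightarrow> w" and "\<And>i. \<not> P (f i)"
proof -
  have "\<exists>x. dist x w < inverse (real (Suc i)) \<and> \<not> P x" for i
  proof (rule ccontr)
    assume "\<not> (\<exists>x. dist x w < inverse (real (Suc i)) \<and> \<not> P x)"
    then have "eventually P (nhds w)"
      unfolding eventually_nhds_metric by (intro exI[of _ "inverse (real (Suc i))"]) auto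
    with assms show False ..
  qed
  then obtain f where f: "\<And>i. dist (f i) w < inverse (real (Suc i))" "\<And>i. \<not> P (f i)" by metis
  have "(\<lambda>i. dist (f i) w) \<longlonglongrightarrow> 0"
    using f(1) by (intro tendsto_sandwich[OF _ _ tendsto_const LIMSEQ_inverse_real_of_nat])
      (auto intro!: always_eventually less_imp_le)
  then have "f \<longlonglongrightarrow> w" using tendsto_dist_iff by blast
  with f(2) that show thesis by blast
qed

text \<open>Points whose weight exceeds that of \<open>\<gamma>\<close> for \<open>w\<close> but not for a nearby vector lie in a
  bounded region.\<close>

lemma weight_bounded_if_crossing:
  assumes e: "e > 0" and c: "e * norm (real_vec c) \<le> weight w c + M"
    and near: "norm (w - v) \<le> e / 2" and cross: "weight v c \<le> weight v \<gamma>"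
  shows "weight w c \<le> norm w * (2 * ((norm w + e / 2) * norm (real_vec \<gamma>) + M) / e)"
proof -
  have "(w - v) \<bullet> real_vec c \<le> norm (w - v) * norm (real_vec c)"
    by (rule norm_cauchy_schwarz)
  also have "\<dots> \<le> e / 2 * norm (real_vec c)" using near by (intro mult_right_mono) auto
  finally have "weight w c \<le> weight v c + e / 2 * norm (real_vec c)"
    by (simp add: weight_def inner_diff_left)
  moreover have "weight v \<gamma> \<le> (norm w + e / 2) * norm (real_vec \<gamma>)"
  proof -
    have "norm v \<le> norm w + e / 2"
      using near norm_triangle_ineq4[of w "w - v"] by simp
    then have "norm v * norm (real_vec \<gamma>) \<le> (norm w + e / 2) * norm (real_vec \<gamma>)"
      by (intro mult_right_mono) auto
    moreover have "weight v \<gamma> \<le> norm v * norm (real_vec \<gamma>)"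
      unfolding weight_def by (rule norm_cauchy_schwarz)
    ultimately show ?thesis by linarith
  qed
  ultimately have "e / 2 * norm (real_vec c) \<le> (norm w + e / 2) * norm (real_vec \<gamma>) + M"
    using c cross by linarith
  then have "norm (real_vec c) \<le> 2 * ((norm w + e / 2) * norm (real_vec \<gamma>) + M) / e"
    using e by (simp add: field_simps)
  moreover have "weight w c \<le> norm w * norm (real_vec c)"
    unfolding weight_def by (rule norm_cauchy_schwarz)
  ultimately show ?thesis by (meson mult_left_mono norm_ge_zero order_trans)
qed

text \<open>Weak inequalities persist as well, because equality of weights for \<open>w\<close>
  means \<open>a = q\<close>. The index from which this holds is uniform in
  \<open>a\<close>.\<close>

lemma stable_sidesD:
  assumes w: "w \<in> lin_indep_vecs" and "stable_sides w A"
    and "f \<longlonglongrightarrow> w" and li: "\<And>i::nat. f i \<in> lin_indep_vecs"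
  shows "\<forall>\<^sub>F i in sequentially. \<forall>a\<in>A. weight w a \<le> weight w q \<longrightarrow> weight (f i) a \<le> weight (f i) q"
proof -
  have "\<forall>\<^sub>F w' in nhds w. w' \<in> lin_indep_vecs \<longrightarrow>
      (\<forall>a\<in>A. weight w a < weight w q \<longrightarrow> weight w' a < weight w' q)"
    using assms(2)[unfolded stable_sides_def, rule_format, of q] by (rule eventually_mono) blast
  then have "\<forall>\<^sub>F i in sequentially. f i \<in> lin_indep_vecs \<longrightarrow>
      (\<forall>a\<in>A. weight w a < weight w q \<longrightarrow> weight (f i) a < weight (f i) q)"
    using assms(3) unfolding filterlim_iff by blast
  then show ?thesis
    by (rule eventually_mono) (metis li less_le order_refl weight_eq_iff[OF w])
qed

text \<open>Otherwise vectors \<open>f i\<close> tending to \<open>w\<close> would see sums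
  \<open>a i + b i\<close> on the wrong side of \<open>\<gamma>\<close>. Along a subsequence the
  summands tend to \<open>q\<close> and \<open>q'\<close> with weights weakly below. For sums below
  \<open>\<gamma>\<close> this forces \<open>\<gamma> = q + q'\<close>, and stability of
  \<open>A\<close> at \<open>q\<close> and of \<open>B\<close> at \<open>q'\<close> prevents the
  crossing. For sums above \<open>\<gamma>\<close> the limit would weigh at most as much as
  \<open>\<gamma>\<close>, yet at least as much as the sums.\<close>

lemma stable_sides_sumset:
  fixes A B :: "(rat ^ 'd) set"
  assumes w: "w \<in> lin_indep_vecs"
    and A: "wo_under (weight w) A" "rational_limits w A"
    and B: "wo_under (weight w) B" "rational_limits w B"
    and sides: "stable_sides w A" "stable_sides w B"
    and bdd: "cone_bounded w ((\<lambda>(a, b). a + b) ` (A \<times> B))"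
  shows "stable_sides w ((\<lambda>(a, b). a + b) ` (A \<times> B))"
proof -
  obtain e M where e: "e > 0" and
    cb: "\<And>a b. a \<in> A \<Longrightarrow> b \<in> B \<Longrightarrow> e * norm (real_vec (a + b)) \<le> weight w (a + b) + M"
    using bdd unfolding cone_bounded_def by (metis SigmaI case_prod_conv image_eqI)
  have below: False
    if f: "f \<longlonglongrightarrow> w" "\<And>i. f i \<in> lin_indep_vecs" and ab: "\<And>i. a i \<in> A" "\<And>i. b i \<in> B"
      and lt: "\<And>i. weight w (a i + b i) < weight w \<gamma>"
      and ge: "\<And>i. weight (f i) (a i + b i) \<ge> weight (f i) \<gamma>"
    for f :: "nat \<Rightarrow> real ^ 'd" and a b :: "nat \<Rightarrow> rat ^ 'd" and \<gamma>
  proof -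
    obtain r q q' where r: "strict_mono r"
      and q: "\<And>i. weight w (a (r i)) \<le> weight w q" and q': "\<And>i. weight w (b (r i)) \<le> weight w q'"
      and z: "(\<lambda>i. real_vec (a (r i) + b (r i))) \<longlonglongrightarrow> real_vec (q + q')"
      by (rule sumset_subseqE[of w A B a b "weight w \<gamma>", OF A B ab less_imp_le[OF lt]])
        (rule that)
    have fr: "(\<lambda>i. f (r i)) \<longlonglongrightarrow> w" using LIMSEQ_subseq_LIMSEQ[OF f(1) r] by (simp add: o_def)
    \<comment> \<open>One inequality is the limit for the fixed vector \<open>w\<close>, the other
      the limit along the moving vectors \<open>f (r i)\<close>.\<close>
    have "weight w (q + q') \<le> weight w \<gamma>"
      using LIMSEQ_le_const2[OF tendsto_weight[OF tendsto_const z]] lt less_imp_le by blast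
    moreover have "weight w \<gamma> \<le> weight w (q + q')"
      using LIMSEQ_le[OF tendsto_weight[OF fr tendsto_const] tendsto_weight[OF fr z]] ge by blast
    ultimately have \<gamma>: "\<gamma> = q + q'" using weight_eq_iff[OF w] by (metis order_antisym)
    have "\<forall>\<^sub>F i in sequentially. weight (f (r i)) (a (r i)) \<le> weight (f (r i)) q"
      using stable_sidesD[OF w sides(1) fr f(2), of q] by (rule eventually_mono) (use ab q in blast)
    moreover have "\<forall>\<^sub>F i in sequentially. weight (f (r i)) (b (r i)) \<le> weight (f (r i)) q'"
      using stable_sidesD[OF w sides(2) fr f(2), of q'] by (rule eventually_mono) (use ab q' in blast)
    ultimately have "\<forall>\<^sub>F i in sequentially.
        weight (f (r i)) (a (r i)) \<le> weight (f (r i)) q \<and>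
        weight (f (r i)) (b (r i)) \<le> weight (f (r i)) q'"
      by (rule eventually_conj)
    then obtain i where "weight (f (r i)) (a (r i)) \<le> weight (f (r i)) q"
      "weight (f (r i)) (b (r i)) \<le> weight (f (r i)) q'"
      using eventually_happens'[OF sequentially_bot] by blast
    \<comment> \<open>Adding the two bounds meets the assumed opposite inequality, so equality
      holds; linear independence of \<open>f (r i)\<close> then identifies the sum with
      \<open>\<gamma>\<close>.\<close>
    then have "weight (f (r i)) (a (r i) + b (r i)) = weight (f (r i)) \<gamma>"
      using ge[of "r i"] by (simp add: \<gamma> weight_add)
    then have "a (r i) + b (r i) = \<gamma>" using weight_eq_iff[OF f(2)] by blast
    with lt[of "r i"] show False by simp
  qed
  have above: False
    if f: "f \<longlonglongrightarrow> w" and ab: "\<And>i. a i \<in> A" "\<And>i. b i \<in> B"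
      and gt: "\<And>i. weight w (a i + b i) > weight w \<gamma>"
      and le: "\<And>i. weight (f i) (a i + b i) \<le> weight (f i) \<gamma>"
    for f :: "nat \<Rightarrow> real ^ 'd" and a b :: "nat \<Rightarrow> rat ^ 'd" and \<gamma>
  proof -
    \<comment> \<open>Dropping the first \<open>k\<close> terms puts the vectors within
      \<open>e / 2\<close> of \<open>w\<close>, where \<open>weight_bounded_if_crossing\<close>
      gives one bound for all weights.\<close>
    have "\<forall>\<^sub>F i in sequentially. dist (f i) w < e / 2"
      using f e unfolding tendsto_iff by (meson half_gt_zero)
    then obtain k where k: "\<And>i. i \<ge> k \<Longrightarrow> dist (f i) w < e / 2"
      unfolding eventually_sequentially by blast
    have near: "norm (w - f (i + k)) \<le> e / 2" for i
      using k[of "i + k"] by (simp add: dist_norm norm_minus_commute)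
    define T where "T = norm w * (2 * ((norm w + e / 2) * norm (real_vec \<gamma>) + M) / e)"
    have bound: "weight w (a (i + k) + b (i + k)) \<le> T" for i
      unfolding T_def by (rule weight_bounded_if_crossing[OF e cb[OF ab] near le])
    obtain r q q' where r: "strict_mono r"
      and q: "\<And>i. weight w (a (r i + k)) \<le> weight w q"
      and q': "\<And>i. weight w (b (r i + k)) \<le> weight w q'"
      and z: "(\<lambda>i. real_vec (a (r i + k) + b (r i + k))) \<longlonglongrightarrow> real_vec (q + q')"
      by (rule sumset_subseqE[of w A B "\<lambda>i. a (i + k)" "\<lambda>i. b (i + k)" T, OF A B ab bound])
        (rule that)
    have "strict_mono (\<lambda>i. r i + k)" using r by (simp add: strict_mono_def)
    then have fr: "(\<lambda>i. f (r i + k)) \<longlonglongrightarrow> w" using LIMSEQ_subseq_LIMSEQ[OF f] by (simp add: o_def)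
    have "weight w (q + q') \<le> weight w \<gamma>"
      using LIMSEQ_le[OF tendsto_weight[OF fr z] tendsto_weight[OF fr tendsto_const]] le by blast
    also have "\<dots> < weight w (a (r 0 + k) + b (r 0 + k))" by (rule gt)
    also have "\<dots> \<le> weight w (q + q')" using q[of 0] q'[of 0] by (simp add: weight_add)
    finally show False by simp
  qed
  show ?thesis unfolding stable_sides_def
  proof (intro allI, rule ccontr)
    fix \<gamma>
    assume "\<not> (\<forall>\<^sub>F w' in nhds w. w' \<in> lin_indep_vecs \<longrightarrow>
      (\<forall>a\<in>(\<lambda>(a, b). a + b) ` (A \<times> B).
        (weight w a < weight w \<gamma> \<longrightarrow> weight w' a < weight w' \<gamma>) \<and>
        (weight w a > weight w \<gamma> \<longrightarrow> weight w' a > weight w' \<gamma>)))"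
    then obtain f where f: "f \<longlonglongrightarrow> w"
      and bad: "\<And>i. \<not> (f i \<in> lin_indep_vecs \<longrightarrow> (\<forall>a\<in>(\<lambda>(a, b). a + b) ` (A \<times> B).
        (weight w a < weight w \<gamma> \<longrightarrow> weight (f i) a < weight (f i) \<gamma>) \<and>
        (weight w a > weight w \<gamma> \<longrightarrow> weight (f i) a > weight (f i) \<gamma>)))"
      by (rule not_eventually_nhdsE) blast
    have li: "f i \<in> lin_indep_vecs" for i using bad by blast
    have "\<forall>i. \<exists>a b. a \<in> A \<and> b \<in> B \<and>
        (weight w (a + b) < weight w \<gamma> \<and> weight (f i) (a + b) \<ge> weight (f i) \<gamma> \<or>
         weight w (a + b) > weight w \<gamma> \<and> weight (f i) (a + b) \<le> weight (f i) \<gamma>)"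
      (is "\<forall>i. ?bad i")
    proof
      fix i
      obtain c where c: "c \<in> (\<lambda>(a, b). a + b) ` (A \<times> B)" and
        "weight w c < weight w \<gamma> \<and> weight (f i) c \<ge> weight (f i) \<gamma> \<or>
         weight w c > weight w \<gamma> \<and> weight (f i) c \<le> weight (f i) \<gamma>"
        using bad[of i] by (meson not_less)
      then show "?bad i" by fast
    qed
    then obtain a b where ab: "\<And>i. a i \<in> A" "\<And>i. b i \<in> B" and
      cases: "\<And>i. (weight w (a i + b i) < weight w \<gamma> \<and> weight (f i) (a i + b i) \<ge> weight (f i) \<gamma>) \<or>
        (weight w (a i + b i) > weight w \<gamma> \<and> weight (f i) (a i + b i) \<le> weight (f i) \<gamma>)"
      by metis
    \<comment> \<open>One of the two kinds of crossing occurs for infinitely many indices.\<close>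
    from cases show False
    proof (rule subseq_disjE)
      fix r :: "nat \<Rightarrow> nat" assume r: "strict_mono r"
      have fr: "(\<lambda>i. f (r i)) \<longlonglongrightarrow> w" using LIMSEQ_subseq_LIMSEQ[OF f r] by (simp add: o_def)
      show False if "\<forall>i. weight w (a (r i) + b (r i)) < weight w \<gamma> \<and>
          weight (f (r i)) (a (r i) + b (r i)) \<ge> weight (f (r i)) \<gamma>"
        using below[of "\<lambda>i. f (r i)" "\<lambda>i. a (r i)" "\<lambda>i. b (r i)" \<gamma>] fr li ab that by blast
      show False if "\<forall>i. weight w (a (r i) + b (r i)) > weight w \<gamma> \<and>
          weight (f (r i)) (a (r i) + b (r i)) \<le> weight (f (r i)) \<gamma>"
        using above[of "\<lambda>i. f (r i)" "\<lambda>i. a (r i)" "\<lambda>i. b (r i)" \<gamma>] fr ab that by blast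
    qed
  qed
qed

section \<open>Closure properties of p-discrete sets\<close>

lemma p_discrete_subset:
  assumes w: "w \<in> lin_indep_vecs" and A: "p_discrete p w A" and BA: "B \<subseteq> A"
  shows "p_discrete p w B"
proof -
  have "\<exists>N>0. B \<subseteq> frac_lattice N p" using A BA by (auto simp: p_discrete_iff[OF w])
  with A wo_near_subset[OF _ BA] cone_bounded_subset[OF _ BA] rational_limits_subset[OF _ BA]
    stable_sides_subset[OF _ BA]
  show ?thesis by (simp add: p_discrete_iff[OF w])
qed

lemma p_discrete_Un:
  assumes w: "w \<in> lin_indep_vecs" and p: "p > 0" and A: "p_discrete p w A" and B: "p_discrete p w B"
  shows "p_discrete p w (A \<union> B)"
proof -
  obtain N M where N: "N > 0" "A \<subseteq> frac_lattice N p" and M: "M > 0" "B \<subseteq> frac_lattice M p"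
    using A B by (auto simp: p_discrete_iff[OF w])
  have "N * M > 0" "A \<union> B \<subseteq> frac_lattice (N * M) p"
    using frac_lattice_mono(1)[OF p M(1) N(2)] frac_lattice_mono(2)[OF p N(1) M(2)] N(1) M(1)
    by auto
  then have "\<exists>N>0. A \<union> B \<subseteq> frac_lattice N p" by blast
  with A B show ?thesis
    by (simp add: p_discrete_iff[OF w] wo_near_Un cone_bounded_Un rational_limits_Un[OF w] stable_sides_Un)
qed

lemma p_discrete_sumset:
  assumes w: "w \<in> lin_indep_vecs" and p: "p > 0" and A: "p_discrete p w A" and B: "p_discrete p w B"
  shows "p_discrete p w ((\<lambda>(a, b). a + b) ` (A \<times> B))"
proof -
  obtain N M where N: "N > 0" "A \<subseteq> frac_lattice N p" and M: "M > 0" "B \<subseteq> frac_lattice M p"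
    using A B by (auto simp: p_discrete_iff[OF w])
  have "N * M > 0" "(\<lambda>(a, b). a + b) ` (A \<times> B) \<subseteq> frac_lattice (N * M) p"
    using frac_lattice_sumset[OF p N(1) M(1) N(2) M(2)] N(1) M(1) by auto
  then have "\<exists>N>0. (\<lambda>(a, b). a + b) ` (A \<times> B) \<subseteq> frac_lattice N p" by blast
  moreover have "wo_under (weight w) A" "wo_under (weight w) B"
    using A B w by (auto simp: p_discrete_iff[OF w] intro: wo_near_imp_wo_under)
  ultimately show ?thesis using A B
    by (simp add: p_discrete_iff[OF w] wo_near_sumset cone_bounded_sumset
        rational_limits_sumset[OF w] stable_sides_sumset[OF w])
qed

lemma wo_under_singleton: "wo_under \<phi> {c}"
  unfolding wo_under_def by (auto intro!: exI[of _ "\<lambda>i. i"] simp: strict_mono_def incseq_def)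

lemma p_discrete_zero:
  assumes w: "w \<in> lin_indep_vecs" and p: "p > 0"
  shows "p_discrete p w {0}"
  unfolding p_discrete_iff[OF w]
proof (intro conjI)
  show "cone_bounded w {0}" unfolding cone_bounded_def
    by (rule exI[of _ 1]) (auto intro: exI[of _ "0 :: real"])
  show "\<exists>N>0. {0} \<subseteq> frac_lattice N p"
    using p by (intro exI[of _ 1]) (simp add: frac_lattice_iff zero_in_p_frac)
  show "rational_limits w {0}" unfolding rational_limits_def
    by (auto intro!: exI[of _ 0])
  show "stable_sides w {0}" unfolding stable_sides_def
  proof
    fix \<gamma>
    have lim: "((\<lambda>w'. weight w' \<gamma>) \<longlongrightarrow> weight w \<gamma>) (nhds w)"
      by (intro tendsto_weight tendsto_const filterlim_ident)
    \<comment> \<open>A nonzero \<open>\<gamma>\<close> has nonzero weight, and by continuity its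
      sign persists near \<open>w\<close>.\<close>
    consider "\<gamma> = 0" | "weight w \<gamma> > 0" | "weight w \<gamma> < 0"
      using weight_eq_iff[OF w, of \<gamma> 0] by fastforce
    then show "\<forall>\<^sub>F w' in nhds w. w' \<in> lin_indep_vecs \<longrightarrow> (\<forall>a\<in>{0}.
      (weight w a < weight w \<gamma> \<longrightarrow> weight w' a < weight w' \<gamma>) \<and>
      (weight w a > weight w \<gamma> \<longrightarrow> weight w' a > weight w' \<gamma>))"
    proof cases
      case 2
      from order_tendstoD(1)[OF lim 2] show ?thesis by (rule eventually_mono) (use 2 in auto)
    next
      case 3
      from order_tendstoD(2)[OF lim 3] show ?thesis by (rule eventually_mono) (use 3 in auto)
    qed simp
  qed
qed (simp_all add: wo_near_def wo_under_singleton)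


subsection \<open>Specialization\<close>

lemma wo_under_ident_iff: "wo_under (\<lambda>x::rat. x) A \<longleftrightarrow> well_ordered_by (\<le>) A"
  using well_ordered_by_image[of "\<lambda>x::rat. x" A] by simp

lemma cring_gen_puiseux: "cring (gen_puiseux :: (rat \<Rightarrow> 'k::field) ring)"
proof -
  let ?p = "char_exponent TYPE('k)"
  let ?P = "\<lambda>A. well_ordered_by (\<le>) A \<and> (\<exists>N>0. A \<subseteq> p_frac N ?p)"
  have p: "?p > 0" by (rule char_exponent_pos)
  have lattice: "\<exists>N>0. A \<union> B \<subseteq> p_frac N ?p"
      "\<exists>N>0. (\<lambda>(a, b). a + b) ` (A \<times> B) \<subseteq> p_frac N ?p"
    if A: "\<exists>N>0. A \<subseteq> p_frac N ?p" and B: "\<exists>N>0. B \<subseteq> p_frac N ?p" for A B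
  proof -
    obtain N M where N: "N > 0" "A \<subseteq> p_frac N ?p" and M: "M > 0" "B \<subseteq> p_frac M ?p"
      using A B by blast
    have "N * M > 0" using N M by simp
    moreover have "A \<union> B \<subseteq> p_frac (N * M) ?p"
      using p_frac_mono(1)[OF p M(1)] p_frac_mono(2)[OF p N(1)] N(2) M(2) by blast
    moreover have "(\<lambda>(a, b). a + b) ` (A \<times> B) \<subseteq> p_frac (N * M) ?p"
      using N(2) M(2) by (auto intro!: p_frac_add[OF p N(1) M(1)])
    ultimately show "\<exists>N>0. A \<union> B \<subseteq> p_frac N ?p"
      "\<exists>N>0. (\<lambda>(a, b). a + b) ` (A \<times> B) \<subseteq> p_frac N ?p" by blast+
  qed
  have "cring (series_ring {f :: rat \<Rightarrow> 'k. ?P (support f)})"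
  proof (rule cring_series_ring)
    show "?P B" if "?P A" "B \<subseteq> A" for A B
      using that wo_under_subset[of "\<lambda>x. x" A B] unfolding wo_under_ident_iff by blast
    show "?P (A \<union> B)" if "?P A" "?P B" for A B
      using that lattice(1)[of A B] wo_under_Un[of "\<lambda>x. x" A B] unfolding wo_under_ident_iff by blast
    show "?P ((\<lambda>(a, b). a + b) ` (A \<times> B))" if "?P A" "?P B" for A B
      using that lattice(2)[of A B] wo_under_sumset[of "\<lambda>x. x" A B] unfolding wo_under_ident_iff
      by blast
    show "?P {0}"
      using wo_under_singleton[of "\<lambda>x. x" "0 :: rat"] zero_in_p_frac[of 1 ?p]
      unfolding wo_under_ident_iff by blast
    show "finite {(a, b) \<in> A \<times> B. a + b = u}" if "?P A" "?P B" for A B u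
      using that finite_sumset_fibre[of "\<lambda>x. x" A B u] unfolding wo_under_ident_iff by simp
  qed
  then show ?thesis by (simp add: gen_puiseux_def p_frac_def)
qed

definition K_C_exponents :: "nat \<Rightarrow> real ^ 'd \<Rightarrow> (real ^ 'd) set \<Rightarrow> (rat ^ 'd) set \<Rightarrow> bool" where
  "K_C_exponents p w C A \<longleftrightarrow>
    p_discrete p w A \<and> (\<forall>w' \<in> C \<inter> lin_indep_vecs. wo_under (weight w') A) \<and> A \<subseteq> frac_lattice 1 p"

lemma K_C_eq:
  "(K_C w C :: (rat ^ 'd \<Rightarrow> 'k::field) ring)
    = series_ring {f. K_C_exponents (char_exponent TYPE('k)) w C (support f)}"
proof -
  have "(\<forall>w' \<in> C \<inter> lin_indep_vecs. well_ordered_by (\<lambda>u v. weight w' u \<le> weight w' v) A) \<longleftrightarrow>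
    (\<forall>w' \<in> C \<inter> lin_indep_vecs. wo_under (weight w') A)" for A
    using well_ordered_by_iff_wo_under[OF inj_on_subset[OF inj_weight subset_UNIV]] by blast
  then show ?thesis
    by (simp add: K_C_def K_w_def series_ring_def K_C_exponents_def)
qed

lemma cring_K_C:
  assumes w: "w \<in> lin_indep_vecs" "w \<in> C"
  shows "cring (K_C w C :: (rat ^ 'd \<Rightarrow> 'k::field) ring)"
  unfolding K_C_eq
proof (rule cring_series_ring)
  let ?p = "char_exponent TYPE('k)"
  let ?P = "K_C_exponents ?p w C"
  have p: "?p > 0" by (rule char_exponent_pos)
  show "?P B" if "?P A" "B \<subseteq> A" for A B
    using that p_discrete_subset[OF w(1)] wo_under_subset unfolding K_C_exponents_def by blast
  show "?P (A \<union> B)" if "?P A" "?P B" for A B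
    using that p_discrete_Un[OF w(1) p] wo_under_Un unfolding K_C_exponents_def by blast
  show "?P ((\<lambda>(a, b). a + b) ` (A \<times> B))" if "?P A" "?P B" for A B
  proof -
    have "wo_under (weight w') ((\<lambda>(a, b). a + b) ` (A \<times> B))" if "w' \<in> C \<inter> lin_indep_vecs" for w'
      using \<open>?P A\<close> \<open>?P B\<close> that unfolding K_C_exponents_def
      by (intro wo_under_sumset weight_add) blast+
    then show ?thesis
      using that p_discrete_sumset[OF w(1) p, of A B] frac_lattice_sumset[OF p, of 1 1 A B]
      unfolding K_C_exponents_def by simp
  qed
  show "?P {0}"
    using p_discrete_zero[OF w(1) p] wo_under_singleton
    by (auto simp: K_C_exponents_def frac_lattice_iff[OF p] zero_in_p_frac)
  show "finite {(a, b) \<in> A \<times> B. a + b = u}" if "?P A" "?P B" for A B u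
    using that w finite_sumset_fibre[OF _ _ inj_weight[OF w(1)] weight_add]
    unfolding K_C_exponents_def by blast
qed

text \<open>Each nontrivial rational relation excludes at most one value of the perturbation parameter.\<close>

lemma ex_lin_indep_perturbation:
  fixes v w :: "real ^ 'd"
  assumes w: "w \<in> lin_indep_vecs" and C: "open C" "v \<in> C"
  obtains e where "v + e *\<^sub>R w \<in> C \<inter> lin_indep_vecs" and "v - e *\<^sub>R w \<in> C \<inter> lin_indep_vecs"
proof -
  \<comment> \<open>The quotient is the only parameter for which a nontrivial relation
    \<open>c\<close> can hold on \<open>v + e *\<^sub>R w\<close>. The zero relation contributes
    just the value 0.\<close>
  define bad where "bad = (\<lambda>c :: 'd \<Rightarrow> rat.
    - (\<Sum>i\<in>UNIV. of_rat (c i) * v $ i) / (\<Sum>i\<in>UNIV. of_rat (c i) * w $ i)) ` UNIV"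
  have li: "v + e *\<^sub>R w \<in> lin_indep_vecs" if e: "e \<notin> bad" for e
    unfolding lin_indep_vecs_def mem_Collect_eq
  proof (intro allI impI, rule ccontr)
    fix c :: "'d \<Rightarrow> rat" and j
    assume zero: "(\<Sum>i\<in>UNIV. of_rat (c i) * (v + e *\<^sub>R w) $ i) = 0" and "c j \<noteq> 0"
    then have "(\<Sum>i\<in>UNIV. of_rat (c i) * w $ i) \<noteq> 0"
      using w unfolding lin_indep_vecs_def by blast
    moreover have "(\<Sum>i\<in>UNIV. of_rat (c i) * v $ i) + e * (\<Sum>i\<in>UNIV. of_rat (c i) * w $ i) = 0"
      using zero by (simp add: distrib_left sum.distrib sum_distrib_left mult_ac)
    ultimately have "e = - (\<Sum>i\<in>UNIV. of_rat (c i) * v $ i) / (\<Sum>i\<in>UNIV. of_rat (c i) * w $ i)"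
      by (simp add: field_simps)
    with e show False unfolding bad_def by blast
  qed
  obtain d where d: "d > 0" "ball v d \<subseteq> C" using C openE by blast
  define d' where "d' = d / (norm w + 1)"
  have w_pos: "norm w + 1 > 0" by (simp add: add_nonneg_pos)
  have d': "d' > 0" unfolding d'_def using d(1) w_pos by simp
  have C': "v + e *\<^sub>R w \<in> C" if "\<bar>e\<bar> < d'" for e
  proof -
    have "norm (e *\<^sub>R w) \<le> \<bar>e\<bar> * (norm w + 1)" by (simp add: mult_left_mono)
    also have "\<dots> < d" using that w_pos by (simp add: d'_def pos_less_divide_eq)
    finally show ?thesis using d(2) by (auto simp: dist_norm)
  qed
  have "countable bad" unfolding bad_def by (intro countable_image countableI_type)
  \<comment> \<open>Both \<open>e\<close> and \<open>- e\<close> have to avoid the countable set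
    \<open>bad\<close>, so its negatives are excluded too; an interval of admissible parameters is
    uncountable.\<close>
  then have "countable (bad \<union> uminus ` bad)" by simp
  moreover have "uncountable {0<..<d'}" using d' by (simp add: uncountable_open_interval)
  ultimately have "\<not> {0<..<d'} \<subseteq> bad \<union> uminus ` bad" by (metis countable_subset)
  then obtain e where e: "e \<in> {0<..<d'}" "e \<notin> bad \<union> uminus ` bad" by blast
  have "e \<notin> bad" "- e \<notin> bad" using e(2) by (auto intro: image_eqI[of _ _ "- e"])
  with li[of e] li[of "- e"] C'[of e] C'[of "- e"] e(1) show thesis
    by (intro that[of e]) auto
qed

section \<open>Pairing exponents with an integer vector\<close>

lemma int_dot_zero [simp]: "int_dot n 0 = 0"
  by (simp add: int_dot_def)

lemma int_dot_add: "int_dot n (u + v) = int_dot n u + int_dot n v"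
  by (simp add: int_dot_def distrib_left sum.distrib)

lemma of_rat_int_dot: "of_rat (int_dot n u) = weight (real_vec_int n) u"
  by (simp add: int_dot_def weight_def inner_vec_def real_vec_int_def real_vec_def of_rat_sum
      of_rat_mult)

lemma int_dot_in_p_frac:
  assumes "p > 0" and "u \<in> frac_lattice 1 p"
  shows "int_dot n u \<in> p_frac 1 p"
proof -
  have "(\<Sum>i\<in>I. of_int (n $ i) * u $ i) \<in> p_frac 1 p" if "finite I" for I
    using that
  proof induction
    case (insert i I)
    have "of_int (n $ i) * u $ i \<in> p_frac 1 p"
      using assms by (intro p_frac_of_int_mult) (simp add: frac_lattice_iff)
    from p_frac_add[OF assms(1) _ _ this insert.IH] insert.hyps show ?case by simp
  qed (simp add: zero_in_p_frac)
  then show ?thesis by (simp add: int_dot_def)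
qed

lemma
  fixes n :: "int ^ 'd" and w :: "real ^ 'd"
  assumes w: "w \<in> lin_indep_vecs" and C: "open C" "real_vec_int n \<in> C"
    and A: "\<And>w'. w' \<in> C \<inter> lin_indep_vecs \<Longrightarrow> wo_under (weight w') A"
  shows wo_under_int_dot: "wo_under (int_dot n) A"
    and finite_int_dot_fibre: "finite {u \<in> A. int_dot n u = s}"
proof -
  obtain e where e: "real_vec_int n + e *\<^sub>R w \<in> C \<inter> lin_indep_vecs" (is "?v \<in> _")
    "real_vec_int n - e *\<^sub>R w \<in> C \<inter> lin_indep_vecs" (is "?v' \<in> _")
    using ex_lin_indep_perturbation[OF w C] .
  have sum: "weight ?v u + weight ?v' u = 2 * of_rat (int_dot n u)" for u
    unfolding of_rat_int_dot by (simp add: weight_def inner_add_left inner_diff_left)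
  show "wo_under (int_dot n) A" unfolding wo_under_def
  proof (intro allI impI)
    fix x :: "nat \<Rightarrow> _" assume x: "\<forall>i. x i \<in> A"
    then obtain r where r: "strict_mono r" and inc: "incseq (\<lambda>i. weight ?v (x (r i)))"
        "incseq (\<lambda>i. weight ?v' (x (r i)))"
      using wo_under_pairE[OF A[OF e(1)] A[OF e(2)], of x x] by blast
    have "int_dot n (x (r i)) \<le> int_dot n (x (r j))" if "i \<le> j" for i j
    proof -
      have "2 * of_rat (int_dot n (x (r i))) \<le> (2 * of_rat (int_dot n (x (r j))) :: real)"
        unfolding sum[symmetric] using inc that by (intro add_mono) (auto simp: incseq_def)
      then show ?thesis by (simp add: of_rat_less_eq)
    qed
    with r show "\<exists>r. strict_mono r \<and> incseq (\<lambda>i. int_dot n (x (r i)))"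
      by (auto simp: incseq_def)
  qed
  show "finite {u \<in> A. int_dot n u = s}"
  \<comment> \<open>On a fibre of \<open>int_dot n\<close> the two perturbed weights add up to the
    constant \<open>2 * of_rat s\<close>.\<close>
  proof (rule finite_if_wo_under_sum_const)
    show "wo_under (weight ?v) {u \<in> A. int_dot n u = s}"
      by (rule wo_under_subset[OF A[OF e(1)]]) blast
    show "wo_under (weight ?v') {u \<in> A. int_dot n u = s}"
      by (rule wo_under_subset[OF A[OF e(2)]]) blast
    show "inj_on (weight ?v) {u \<in> A. int_dot n u = s}"
      using e(1) by (intro inj_on_subset[OF inj_weight]) auto
    show "weight ?v u + weight ?v' u = 2 * of_rat s" if "u \<in> {u \<in> A. int_dot n u = s}" for u
      using that sum by simp
  qed
qed

section \<open>Powers with exponents whose denominators are powers of p\<close>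

lemma p_frac_common_denominator:
  assumes "p > 0" "x \<in> p_frac 1 p" "y \<in> p_frac 1 p"
  obtains m l :: int and j where "x = of_int m / of_nat (p ^ j)" "y = of_int l / of_nat (p ^ j)"
proof -
  obtain m j where x: "x = of_int m / of_nat (1 * p ^ j)"
    using assms(2) unfolding p_frac_def by blast
  obtain l k where y: "y = of_int l / of_nat (1 * p ^ k)"
    using assms(3) unfolding p_frac_def by blast
  show thesis
    using that[of "m * int (1 * p ^ k)" "j + k" "l * int (1 * p ^ j)"]
      p_frac_raise[OF assms(1), of 1 m 1 j k] p_frac_raise[OF assms(1), of 1 l 1 k j] x y
    by (simp add: add.commute)
qed

context
  fixes t :: "'k::alg_closed_field"
  assumes t: "t \<noteq> 0"
begin

text \<open>Over a common denominator a single root \<open>r\<close> represents all three powers,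
  and the law becomes that of integer powers.\<close>

lemma frac_pow_add:
  assumes "x \<in> p_frac 1 (char_exponent TYPE('k))" "y \<in> p_frac 1 (char_exponent TYPE('k))"
  shows "frac_pow t (x + y) = frac_pow t x * frac_pow t y"
proof -
  let ?p = "char_exponent TYPE('k)"
  obtain m l j where x: "x = of_int m / of_nat (?p ^ j)" and y: "y = of_int l / of_nat (?p ^ j)"
    using p_frac_common_denominator[OF char_exponent_pos assms] .
  obtain r where r: "r ^ (?p ^ j) = t" using char_exponent_root_exists by blast
  then have "r \<noteq> 0" using t char_exponent_pos[where 'k = 'k] by auto
  moreover have "x + y = of_int (m + l) / of_nat (?p ^ j)"
    unfolding x y by (simp add: add_divide_distrib)
  ultimately show ?thesis
    using frac_pow_eq[OF t r] by (metis x y power_int_add)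
qed

lemma frac_pow_zero: "frac_pow t 0 = 1"
  using frac_pow_eq[OF t, of t 0 0] by simp

lemma frac_pow_nonzero:
  assumes "x \<in> p_frac 1 (char_exponent TYPE('k))"
  shows "frac_pow t x \<noteq> 0"
proof -
  let ?p = "char_exponent TYPE('k)"
  obtain m j where x: "x = of_int m / of_nat (?p ^ j)"
    using p_frac_common_denominator[OF char_exponent_pos assms assms] .
  obtain r where r: "r ^ (?p ^ j) = t" using char_exponent_root_exists by blast
  then have "r \<noteq> 0" using t char_exponent_pos[where 'k = 'k] by auto
  then show ?thesis by (simp only: x frac_pow_eq[OF t r]) simp
qed

end

section \<open>The specialization map\<close>

context
  fixes \<theta> :: "'k::alg_closed_field ^ 'd" and n :: "int ^ 'd"
  assumes \<theta>: "\<And>i. \<theta> $ i \<noteq> 0"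
begin

lemma vec_pow_zero: "vec_pow \<theta> 0 = 1"
  by (simp add: vec_pow_def frac_pow_zero \<theta>)

lemma vec_pow_add:
  assumes "u \<in> frac_lattice 1 (char_exponent TYPE('k))"
    and "v \<in> frac_lattice 1 (char_exponent TYPE('k))"
  shows "vec_pow \<theta> (u + v) = vec_pow \<theta> u * vec_pow \<theta> v"
  using assms
  by (simp add: vec_pow_def frac_lattice_iff[OF char_exponent_pos] frac_pow_add \<theta> prod.distrib)

lemma vec_pow_nonzero:
  assumes "u \<in> frac_lattice 1 (char_exponent TYPE('k))"
  shows "vec_pow \<theta> u \<noteq> 0"
  using assms by (simp add: vec_pow_def frac_lattice_iff[OF char_exponent_pos] frac_pow_nonzero \<theta>)

lemma support_mult_vec_pow:
  assumes "support f \<subseteq> frac_lattice 1 (char_exponent TYPE('k))"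
  shows "support (\<lambda>u. f u * vec_pow \<theta> u) = support f"
  using assms vec_pow_nonzero by (auto simp: support_def)

text \<open>The factors \<open>vec_pow \<theta> u\<close> are nonzero on the support, so multiplying
  by them leaves the index set of the sum unchanged.\<close>

lemma specialize_eq_push:
  assumes "support f \<subseteq> frac_lattice 1 (char_exponent TYPE('k))"
  shows "specialize \<theta> n f = push (int_dot n) (\<lambda>u. f u * vec_pow \<theta> u)"
  using support_mult_vec_pow[OF assms]
  by (simp add: fun_eq_iff specialize_def push_def support_def set_eq_iff)

text \<open>Since \<open>vec_pow \<theta>\<close> turns sums of exponents into products, multiplying
  coefficients by it respects convolution.\<close>

lemma convolve_mult_vec_pow:
  assumes "support f \<subseteq> frac_lattice 1 (char_exponent TYPE('k))"
    and "support g \<subseteq> frac_lattice 1 (char_exponent TYPE('k))"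
  shows "convolve f g u * vec_pow \<theta> u
    = convolve (\<lambda>u. f u * vec_pow \<theta> u) (\<lambda>u. g u * vec_pow \<theta> u) u"
  unfolding convolve_def support_mult_vec_pow[OF assms(1)] support_mult_vec_pow[OF assms(2)]
    sum_distrib_right
proof (rule sum.cong[OF refl])
  fix x assume "x \<in> {(a, b). (a, b) \<in> support f \<times> support g \<and> a + b = u}"
  then obtain a b where "x = (a, b)" "a \<in> support f" "b \<in> support g" "u = a + b" by blast
  with assms show "(case x of (a, b) \<Rightarrow> f a * g b) * vec_pow \<theta> u
      = (case x of (a, b) \<Rightarrow> f a * vec_pow \<theta> a * (g b * vec_pow \<theta> b))"
    by (simp add: vec_pow_add subset_iff)
qed

text \<open>By additivity of \<open>int_dot n\<close>, adding exponents before or after pairing with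
  \<open>n\<close> is the same map on pairs. Both sides are the pushforward of one tensor along this
  map, factored in two ways.\<close>

lemma specialize_convolve:
  assumes f: "support f \<subseteq> frac_lattice 1 (char_exponent TYPE('k))"
    and g: "support g \<subseteq> frac_lattice 1 (char_exponent TYPE('k))"
    and wo: "wo_under (int_dot n) (support f)" "wo_under (int_dot n) (support g)"
    and fin: "\<And>s. finite {u \<in> support f. int_dot n u = s}"
      "\<And>s. finite {u \<in> support g. int_dot n u = s}"
  shows "specialize \<theta> n (convolve f g) = convolve (specialize \<theta> n f) (specialize \<theta> n g)"
proof
  fix s
  let ?f = "\<lambda>u. f u * vec_pow \<theta> u" and ?g = "\<lambda>u. g u * vec_pow \<theta> u"
  let ?T = "{(a, b) \<in> int_dot n ` support f \<times> int_dot n ` support g. a + b = s}"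
  let ?S = "{x \<in> support (tensor ?f ?g). int_dot n (fst x) + int_dot n (snd x) = s}"
  \<comment> \<open>There are finitely many ways to write \<open>s\<close> as a sum of two values of
    \<open>int_dot n\<close>, and each value is attained finitely often on the supports.\<close>
  have "finite ?T"
    using finite_sumset_fibre[of "\<lambda>x. x" "int_dot n ` support f" "int_dot n ` support g" s] wo
    by (simp add: wo_under_image)
  then have "finite (\<Union>(a, b)\<in>?T. {u \<in> support f. int_dot n u = a} \<times> {u \<in> support g. int_dot n u = b})"
    using fin by (intro finite_UN_I) auto
  moreover have "?S \<subseteq> (\<Union>(a, b)\<in>?T.
      {u \<in> support f. int_dot n u = a} \<times> {u \<in> support g. int_dot n u = b})"
    by (fastforce simp: support_def tensor_def)
  ultimately have finS: "finite ?S" by (rule rev_finite_subset)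
  have fg: "support (convolve f g) \<subseteq> frac_lattice 1 (char_exponent TYPE('k))"
    using support_convolve[of f g] frac_lattice_sumset[OF char_exponent_pos _ _ f g] by fastforce
  have "specialize \<theta> n (convolve f g) s
      = push (int_dot n) (push (\<lambda>(a, b). a + b) (tensor ?f ?g)) s"
    unfolding specialize_eq_push[OF fg] convolve_mult_vec_pow[OF f g]
    by (simp only: convolve_eq_push)
  also have "\<dots> = push (\<lambda>x. int_dot n ((\<lambda>(a, b). a + b) x)) (tensor ?f ?g) s"
    by (rule push_push) (use finS in \<open>simp add: case_prod_unfold int_dot_add\<close>)
  also have "\<dots> = push (\<lambda>x. (\<lambda>(a, b). a + b) (map_prod (int_dot n) (int_dot n) x)) (tensor ?f ?g) s"
    by (simp add: case_prod_unfold int_dot_add)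
  also have "\<dots> = push (\<lambda>(a, b). a + b) (push (map_prod (int_dot n) (int_dot n)) (tensor ?f ?g)) s"
    by (rule push_push[symmetric]) (use finS in \<open>simp add: case_prod_unfold\<close>)
  also have "\<dots> = convolve (specialize \<theta> n f) (specialize \<theta> n g) s"
    by (simp only: specialize_eq_push[OF f] specialize_eq_push[OF g] convolve_eq_push tensor_push)
  finally show "specialize \<theta> n (convolve f g) s = convolve (specialize \<theta> n f) (specialize \<theta> n g) s" .
qed

lemma specialize_add:
  assumes f: "support f \<subseteq> frac_lattice 1 (char_exponent TYPE('k))"
    and g: "support g \<subseteq> frac_lattice 1 (char_exponent TYPE('k))"
    and fin: "\<And>s. finite {u \<in> support f. int_dot n u = s}"
      "\<And>s. finite {u \<in> support g. int_dot n u = s}"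
  shows "specialize \<theta> n (\<lambda>u. f u + g u) = (\<lambda>s. specialize \<theta> n f s + specialize \<theta> n g s)"
proof -
  have fg: "support (\<lambda>u. f u + g u) \<subseteq> frac_lattice 1 (char_exponent TYPE('k))"
    using f g by (fastforce simp: support_def)
  show ?thesis
    unfolding specialize_eq_push[OF fg] specialize_eq_push[OF f] specialize_eq_push[OF g]
      distrib_right
    by (intro ext push_add)
      (simp_all only: support_mult_vec_pow[OF f] support_mult_vec_pow[OF g] fin)
qed

lemma specialize_one:
  "specialize \<theta> n (\<lambda>u. if u = 0 then 1 else 0) = (\<lambda>s. if s = 0 then 1 else 0)"
proof
  fix s
  have "{u \<in> support (\<lambda>u. if u = 0 then 1 else 0 :: 'k). int_dot n u = s}
      = (if s = 0 then {0} else {})"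
    by (auto simp: support_def)
  then show "specialize \<theta> n (\<lambda>u. if u = 0 then 1 else 0) s = (if s = 0 then 1 else 0)"
    by (simp add: specialize_def vec_pow_zero)
qed

lemma support_specialize: "support (specialize \<theta> n f) \<subseteq> int_dot n ` support f"
proof
  fix s assume "s \<in> support (specialize \<theta> n f)"
  then have "{u \<in> support f. int_dot n u = s} \<noteq> {}"
    unfolding support_def[of "specialize \<theta> n f"] specialize_def by (metis (mono_tags) mem_Collect_eq sum.empty)
  then show "s \<in> int_dot n ` support f" by blast
qed

text \<open>Pairing with an integer vector creates no new denominators, so \<open>N = 1\<close>
  suffices.\<close>

lemma specialize_in_gen_puiseux:
  assumes f: "support f \<subseteq> frac_lattice 1 (char_exponent TYPE('k))"
    and wo: "wo_under (int_dot n) (support f)"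
  shows "specialize \<theta> n f \<in> carrier gen_puiseux"
proof -
  have "wo_under (\<lambda>x. x) (support (specialize \<theta> n f))"
    by (rule wo_under_subset[OF _ support_specialize]) (simp add: wo_under_image wo)
  moreover have "support (specialize \<theta> n f) \<subseteq> p_frac 1 (char_exponent TYPE('k))"
    using support_specialize[of f] f int_dot_in_p_frac[OF char_exponent_pos] by blast
  ultimately show ?thesis
    unfolding gen_puiseux_def series_ring_def p_frac_def[symmetric] wo_under_ident_iff
    by (auto intro: exI[of _ 1])
qed

end

text \<open>Finiteness of the fibres is stated separately because \<open>sum\<close> would silently
  return 0 on an infinite index set. That the values lie in the target, and that source and target
  are rings, is contained in \<open>ring_hom_ring\<close>.\<close>

theorem lemma4p2:
  fixes w :: "real ^ 'd" and C :: "(real ^ 'd) set"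
    and n :: "int ^ 'd" and \<theta> :: "'k::alg_closed_field ^ 'd"
  assumes "w \<in> lin_indep_vecs"
    and "open_cone C" and "w \<in> C"
    and "real_vec_int n \<in> C"
    and "\<forall>i. \<theta> $ i \<noteq> 0"
  shows "(\<forall>f \<in> carrier (K_C w C :: (rat ^ 'd \<Rightarrow> 'k) ring). \<forall>s.
            finite {u \<in> support f. int_dot n u = s})
    \<and> ring_hom_ring (K_C w C) gen_puiseux (specialize \<theta> n)"
proof -
  let ?K = "K_C w C :: (rat ^ 'd \<Rightarrow> 'k) ring"
  have \<theta>: "\<And>i. \<theta> $ i \<noteq> 0" and C: "open C" using assms by (auto simp: open_cone_def)
  have K: "support f \<subseteq> frac_lattice 1 (char_exponent TYPE('k))"
      "\<And>w'. w' \<in> C \<inter> lin_indep_vecs \<Longrightarrow> wo_under (weight w') (support f)"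
    if "f \<in> carrier ?K" for f
    using that by (auto simp: K_C_eq series_ring_def K_C_exponents_def)
  have wo: "wo_under (int_dot n) (support f)"
    and fin: "finite {u \<in> support f. int_dot n u = s}" if "f \<in> carrier ?K" for f s
    using wo_under_int_dot[OF assms(1) C assms(4) K(2)[OF that]]
      finite_int_dot_fibre[OF assms(1) C assms(4) K(2)[OF that]] by blast+
  have "ring_hom_ring ?K gen_puiseux (specialize \<theta> n)"
  proof (rule ring_hom_ringI)
    show "ring ?K" "ring (gen_puiseux :: (rat \<Rightarrow> 'k) ring)"
      using cring_K_C[OF assms(1,3)] cring_gen_puiseux by (auto intro: cring.axioms)
    show "specialize \<theta> n f \<in> carrier gen_puiseux" if "f \<in> carrier ?K" for f
      using specialize_in_gen_puiseux[OF \<theta> K(1) wo] that by blast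
    show "specialize \<theta> n (f \<otimes>\<^bsub>?K\<^esub> g) = specialize \<theta> n f \<otimes>\<^bsub>gen_puiseux\<^esub> specialize \<theta> n g"
      if "f \<in> carrier ?K" "g \<in> carrier ?K" for f g
      using specialize_convolve[OF \<theta> K(1) K(1) wo wo fin fin] that
      by (simp add: K_C_eq gen_puiseux_def series_ring_def)
    show "specialize \<theta> n (f \<oplus>\<^bsub>?K\<^esub> g) = specialize \<theta> n f \<oplus>\<^bsub>gen_puiseux\<^esub> specialize \<theta> n g"
      if "f \<in> carrier ?K" "g \<in> carrier ?K" for f g
      using specialize_add[OF \<theta> K(1) K(1) fin fin] that
      by (simp add: K_C_eq gen_puiseux_def series_ring_def)
    show "specialize \<theta> n \<one>\<^bsub>?K\<^esub> = \<one>\<^bsub>gen_puiseux\<^esub>"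
      by (simp add: K_C_eq gen_puiseux_def series_ring_def specialize_one[OF \<theta>])
  qed
  with fin show ?thesis by blast
qed

end
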